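(* Let $I=(a,b)$ be an open interval, $m$ a fully supported Radon measure on $I$, and $\mathtt{s}$ a scaling function on $I$. Let $\{G_n:n\ge1\}\subset\mathbf{G}_{\mathtt{s}}(I)$ be a decreasing sequence, i.e. $G_n\supset G_{n+1}$ $d\mathtt{s}$-a.e. for every $n$; let $\mathtt{s}_n$ be the scaling function associated with $G_n$, and set $(\bar{\mathcal{E}}^n,\bar{\mathcal{F}}^n):=(\mathcal{E}^{(\mathtt{s}_n,m)},\mathcal{F}^{(\mathtt{s}_n,m)})$. Let $G:=\bigcap_{n\ge1}G_n$ (a subset of $I$, not necessarily in $\mathbf{G}_{\mathtt{s}}(I)$), $F:=G^c=I\setminus G$, and define $$\bar{\mathcal{F}}:=\Big\{u\in\mathcal{F}^{(\mathtt{s},m)}:\frac{du}{d\mathtt{s}}=0\ \ d\mathtt{s}\text{-a.e. on }F\Big\},\qquad \bar{\mathcal{E}}(u,v):=\frac12\int_I\frac{du}{d\mathtt{s}}\frac{dv}{d\mathtt{s}}\,d\mathtt{s},\quad u,v\in\bar{\mathcal{F}}.$$ Then $(\bar{\mathcal{E}}^n,\bar{\mathcal{F}}^n)$ converges to $(\bar{\mathcal{E}},\bar{\mathcal{F}})$ in the sense of Mosco as $n\to\infty$.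
   Context: A scaling function on $I$ is a strictly increasing continuous function $\mathtt{s}:I\to\mathbf{R}$; $d\mathtt{s}$ denotes its Lebesgue–Stieltjes measure. For a function $u$ on $I$, $u\ll\mathtt{s}$ means $u(y)-u(x)=\int_x^y v\,d\mathtt{s}$ for all $x<y$ in $I$ for some locally $d\mathtt{s}$-integrable $v$, and then $\frac{du}{d\mathtt{s}}:=v$. Define $$\mathcal{F}^{(\mathtt{s},m)}:=\{u\in L^2(I,m): u\ll\mathtt{s},\ \tfrac{du}{d\mathtt{s}}\in L^2(I,d\mathtt{s})\},\qquad \mathcal{E}^{(\mathtt{s},m)}(u,v):=\tfrac12\int_I\frac{du}{d\mathtt{s}}\frac{dv}{d\mathtt{s}}\,d\mathtt{s}.$$ $\mathbf{G}_{\mathtt{s}}(I)$ is the collection of (measurable) sets $G\subset I$, identified up to $d\mathtt{s}$-null sets, such that $\int_{G\cap(c,d)}d\mathtt{s}>0$ for all $c<d$ in $I$. Fix a point $e\in I$. The scaling function associated with $G\in\mathbf{G}_{\mathtt{s}}(I)$ is $\tilde{\mathtt{s}}(x)=\int_e^x 1_G\,d\mathtt{s}$, i.e. the scaling function with $\tilde{\mathtt{s}}(e)=0$, $\tilde{\mathtt{s}}\ll\mathtt{s}$ and $\frac{d\tilde{\mathtt{s}}}{d\mathtt{s}}=1_G$ $d\mathtt{s}$-a.e. Mosco convergence is considered for closed forms in the wide sense on $L^2(I,m)$, i.e. nonnegative symmetric bilinear forms $(\mathcal{E},\mathcal{F})$ satisfying all conditions of closed forms except that the domain $\mathcal{F}$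 need not be dense in $L^2(I,m)$. Such a form is extended by $\mathcal{E}(u,u)=\infty$ for $u\in L^2(I,m)\setminus\mathcal{F}$. $(\mathcal{E}^n,\mathcal{F}^n)$ converges to $(\mathcal{E},\mathcal{F})$ in the sense of Mosco if (a) whenever $u_n\to u$ weakly in $L^2(I,m)$, $\liminf_{n}\mathcal{E}^n(u_n,u_n)\ge\mathcal{E}(u,u)$; and (b) for every $u\in L^2(I,m)$ there is a sequence $u_n\to u$ strongly in $L^2(I,m)$ with $\limsup_n\mathcal{E}^n(u_n,u_n)\le\mathcal{E}(u,u)$. *)

theory Defs
  imports "HOL-Analysis.Analysis"
begin

section \<open>Mosco convergence of closed forms in the wide sense\<close>

text \<open>
  Elements of \<open>L\<^sup>2(M)\<close> are represented by square integrable functions; equality in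
  \<open>L\<^sup>2(M)\<close> is equality \<open>M\<close>-almost everywhere.
\<close>

definition L2 :: "'a measure \<Rightarrow> ('a \<Rightarrow> real) set" where
  "L2 M = {u \<in> borel_measurable M. integrable M (\<lambda>x. (u x)\<^sup>2)}"

definition inner_L2 :: "'a measure \<Rightarrow> ('a \<Rightarrow> real) \<Rightarrow> ('a \<Rightarrow> real) \<Rightarrow> real" where
  "inner_L2 M u v = (LINT x|M. u x * v x)"

definition strongly_converges_L2 ::
    "'a measure \<Rightarrow> (nat \<Rightarrow> 'a \<Rightarrow> real) \<Rightarrow> ('a \<Rightarrow> real) \<Rightarrow> bool" where
  "strongly_converges_L2 M U u \<longleftrightarrow>
     (\<forall>n. U n \<in> L2 M) \<and> u \<in> L2 M \<and> (\<lambda>n. LINT x|M. (U n x - u x)\<^sup>2) \<longlonglongrightarrow> 0"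

definition weakly_converges_L2 ::
    "'a measure \<Rightarrow> (nat \<Rightarrow> 'a \<Rightarrow> real) \<Rightarrow> ('a \<Rightarrow> real) \<Rightarrow> bool" where
  "weakly_converges_L2 M U u \<longleftrightarrow>
     (\<forall>n. U n \<in> L2 M) \<and> u \<in> L2 M \<and>
     (\<forall>v\<in>L2 M. (\<lambda>n. inner_L2 M (U n) v) \<longlonglongrightarrow> inner_L2 M u v)"

text \<open>
  A form is given by its domain \<open>D\<close>, a set of functions (not necessarily closed under
  modification on null sets), and its values \<open>E u v\<close> for \<open>u, v \<in> D\<close>. The condition on
  \<open>AE\<close>-equal functions says that \<open>E\<close> is well defined on the \<open>L\<^sup>2(M)\<close>-classes that have a
  representative in \<open>D\<close>. Closedness is completeness of \<open>D\<close> for the inner product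
  \<open>E u v + inner_L2 M u v\<close>. Density of \<open>D\<close> in \<open>L\<^sup>2(M)\<close> is not required.
\<close>

definition closed_form_wide ::
    "'a measure \<Rightarrow> ('a \<Rightarrow> real) set \<Rightarrow> (('a \<Rightarrow> real) \<Rightarrow> ('a \<Rightarrow> real) \<Rightarrow> real) \<Rightarrow> bool" where
  "closed_form_wide M D E \<longleftrightarrow>
     D \<subseteq> L2 M \<and>
     (\<lambda>x. 0) \<in> D \<and>
     (\<forall>u\<in>D. \<forall>v\<in>D. \<forall>\<alpha> \<beta>. (\<lambda>x. \<alpha> * u x + \<beta> * v x) \<in> D) \<and>
     (\<forall>u\<in>D. \<forall>v\<in>D. \<forall>w\<in>D. \<forall>\<alpha> \<beta>.
        E (\<lambda>x. \<alpha> * u x + \<beta> * v x) w = \<alpha> * E u w + \<beta> * E v w) \<and>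
     (\<forall>u\<in>D. \<forall>v\<in>D. E u v = E v u) \<and>
     (\<forall>u\<in>D. 0 \<le> E u u) \<and>
     (\<forall>u\<in>D. \<forall>v\<in>D. (AE x in M. u x = v x) \<longrightarrow> (\<forall>w\<in>D. E u w = E v w)) \<and>
     (\<forall>U. (\<forall>n. U n \<in> D) \<and>
        (\<forall>\<epsilon>>0. \<exists>N. \<forall>k\<ge>N. \<forall>l\<ge>N.
           E (\<lambda>x. U k x - U l x) (\<lambda>x. U k x - U l x)
             + (LINT x|M. (U k x - U l x)\<^sup>2) < \<epsilon>) \<longrightarrow>
        (\<exists>u\<in>D. (\<lambda>n. E (\<lambda>x. U n x - u x) (\<lambda>x. U n x - u x)
             + (LINT x|M. (U n x - u x)\<^sup>2)) \<longlonglongrightarrow> 0))"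

text \<open>
  Extension of \<open>u \<mapsto> E u u\<close> to \<open>L\<^sup>2(M)\<close>: it is \<open>E v v\<close> if \<open>u\<close> has a representative
  \<open>v \<in> D\<close>, and \<open>\<infinity>\<close> otherwise. For a form in the sense above all representatives give the same
  value, so the infimum only serves to select it; the infimum of the empty set is \<open>\<infinity>\<close>.
\<close>

definition extended_energy ::
    "'a measure \<Rightarrow> ('a \<Rightarrow> real) set \<Rightarrow> (('a \<Rightarrow> real) \<Rightarrow> ('a \<Rightarrow> real) \<Rightarrow> real) \<Rightarrow> ('a \<Rightarrow> real) \<Rightarrow> ereal" where
  "extended_energy M D E u = (INF v\<in>{v\<in>D. AE x in M. u x = v x}. ereal (E v v))"

definition mosco_converges ::
    "'a measure \<Rightarrow> (nat \<Rightarrow> ('a \<Rightarrow> real) set) \<Rightarrow> (nat \<Rightarrow> ('a \<Rightarrow> real) \<Rightarrow> ('a \<Rightarrow> real) \<Rightarrow> real) \<Rightarrow>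
     ('a \<Rightarrow> real) set \<Rightarrow> (('a \<Rightarrow> real) \<Rightarrow> ('a \<Rightarrow> real) \<Rightarrow> real) \<Rightarrow> bool" where
  "mosco_converges M Dn En D E \<longleftrightarrow>
     (\<forall>n. closed_form_wide M (Dn n) (En n)) \<and> closed_form_wide M D E \<and>
     (\<forall>U u. weakly_converges_L2 M U u \<longrightarrow>
        extended_energy M D E u \<le> liminf (\<lambda>n. extended_energy M (Dn n) (En n) (U n))) \<and>
     (\<forall>u\<in>L2 M. \<exists>U. strongly_converges_L2 M U u \<and>
        limsup (\<lambda>n. extended_energy M (Dn n) (En n) (U n)) \<le> extended_energy M D E u)"


section \<open>Scaling functions and the associated forms\<close>

definition scaling_function :: "real set \<Rightarrow> (real \<Rightarrow> real) \<Rightarrow> bool" where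
  "scaling_function I s \<longleftrightarrow> strict_mono_on I s \<and> continuous_on I s"

text \<open>Every locally finite Borel measure on an open interval is Radon, that is, also regular.\<close>

definition fully_supported_radon :: "real set \<Rightarrow> real measure \<Rightarrow> bool" where
  "fully_supported_radon I m \<longleftrightarrow>
     sets m = sets (restrict_space borel I) \<and>
     (\<forall>K. compact K \<and> K \<subseteq> I \<longrightarrow> emeasure m K < \<infinity>) \<and>
     (\<forall>U. open U \<and> U \<subseteq> I \<and> U \<noteq> {} \<longrightarrow> 0 < emeasure m U)"

text \<open>
  The Lebesgue--Stieltjes measure of a function on \<open>I\<close>. The library's \<^const>\<open>interval_measure\<close>
  is the case \<open>I = UNIV\<close>; it does not apply here since \<open>s\<close> may be unbounded near the end
  points of \<open>I\<close> and then has no monotone extension to the real line.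
\<close>

definition stieltjes :: "real set \<Rightarrow> (real \<Rightarrow> real) \<Rightarrow> real measure" where
  "stieltjes I s = extend_measure I {(c, d). c \<le> d \<and> c \<in> I \<and> d \<in> I}
     (\<lambda>(c, d). {c<..d}) (\<lambda>(c, d). ennreal (s d - s c))"

lemma
  fixes a b :: ereal
  defines "I \<equiv> einterval a b"
  shows space_stieltjes: "space (stieltjes I s) = I"
    and sets_stieltjes: "sets (stieltjes I s) =
      sigma_sets I ((\<lambda>(c, d). {c<..d}) ` {(c, d). c \<le> d \<and> c \<in> I \<and> d \<in> I})"
proof -
  have "(\<lambda>(c, d). {c<..d}) ` {(c, d). c \<le> d \<and> c \<in> I \<and> d \<in> I} \<subseteq> Pow I"
    unfolding I_def einterval_def
    by (auto, (metis less_ereal.simps(1) less_trans), (metis ereal_less_eq(3) le_less_trans))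
  then show "space (stieltjes I s) = I" "sets (stieltjes I s) =
      sigma_sets I ((\<lambda>(c, d). {c<..d}) ` {(c, d). c \<le> d \<and> c \<in> I \<and> d \<in> I})"
    unfolding stieltjes_def by (rule space_extend_measure, rule sets_extend_measure)
qed

lemma emeasure_stieltjes_Ioc:
  fixes a b :: ereal
  defines "I \<equiv> einterval a b"
  assumes s: "scaling_function I s" and cd: "c \<le> d" "c \<in> I" "d \<in> I"
  shows "emeasure (stieltjes I s) {c<..d} = ennreal (s d - s c)"
proof -
  let ?M = "stieltjes I s"
  let ?G = "(\<lambda>(c, d). {c<..d}) ` {(c, d). c \<le> d \<and> c \<in> I \<and> d \<in> I}"
  define g where "g = the_inv_into I s"
  define R where "R = restrict_space lborel (s ` I)"
  define N where "N = distr R ?M g"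
  have sm: "strict_mono_on I s" and cont: "continuous_on I s"
    using s by (auto simp: scaling_function_def)
  have inj: "inj_on s I" using sm by (rule strict_mono_on_imp_inj_on)
  have sub: "{c..d} \<subseteq> I" if "c \<in> I" "d \<in> I" for c d
    using that unfolding I_def einterval_def
    by (auto, (metis ereal_less_eq(3) less_le_trans), (metis ereal_less_eq(3) le_less_trans))
  have int: "is_interval I" unfolding is_interval_1 using sub by fastforce
  have intS: "is_interval (s ` I)"
    using connected_continuous_image[OF cont] int is_interval_connected_1 by blast
  have S: "s ` I \<in> sets borel" using intS by (rule real_interval_borel_measurable)
  have pre: "g -` {c<..d} \<inter> s ` I = {s c<..s d}" if "c \<in> I" "d \<in> I" for c d
  proof -
    have gs: "g (s x) = x" if "x \<in> I" for x
      unfolding g_def using inj that by (rule the_inv_into_f_f)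
    have lt: "s c < s x \<longleftrightarrow> c < x" "s x \<le> s d \<longleftrightarrow> x \<le> d" if "x \<in> I" for x
      using sm that \<open>c \<in> I\<close> \<open>d \<in> I\<close> by (auto simp: strict_mono_on_less strict_mono_on_less_eq)
    have onto: "y \<in> s ` I" if "s c < y" "y \<le> s d" for y
      using intS \<open>c \<in> I\<close> \<open>d \<in> I\<close> that unfolding is_interval_1 by (meson image_eqI less_imp_le)
    show ?thesis
    proof (rule set_eqI)
      fix y
      show "y \<in> g -` {c<..d} \<inter> s ` I \<longleftrightarrow> y \<in> {s c<..s d}"
      proof (cases "y \<in> s ` I")
        case True
        then obtain x where "x \<in> I" "y = s x" by blast
        then show ?thesis using gs lt by simp
      next
        case False
        then show ?thesis using onto by auto
      qed
    qed
  qed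
  have spR: "space R = s ` I" by (simp add: R_def space_restrict_space)
  have setR: "sets R = sets (restrict_space borel (s ` I))"
    unfolding R_def by (rule sets_restrict_space_cong) simp
  have pow: "?G \<subseteq> Pow I" using sub by fastforce
  have meas: "g \<in> measurable R ?M"
  proof (rule measurable_sigma_sets)
    show "sets ?M = sigma_sets I ?G" unfolding I_def by (rule sets_stieltjes)
    show "?G \<subseteq> Pow I" by (rule pow)
    show "g \<in> space R \<rightarrow> I" unfolding spR g_def using inj by (auto simp: the_inv_into_f_f)
    fix y assume "y \<in> ?G"
    then obtain c d where y: "y = {c<..d}" "c \<in> I" "d \<in> I" by auto
    have "{s c<..s d} \<subseteq> s ` I" using pre[OF y(2,3)] by blast
    then show "g -` y \<inter> space R \<in> sets R"
      unfolding y(1) spR pre[OF y(2,3)] setR using S by (simp add: sets_restrict_space_iff)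
  qed
  have val: "emeasure N {c<..d} = ennreal (s d - s c)" if "c \<le> d" "c \<in> I" "d \<in> I" for c d
  proof -
    have sd: "s c \<le> s d" using sm that by (simp add: strict_mono_on_less_eq)
    have "{c<..d} \<in> sets ?M"
      unfolding I_def sets_stieltjes using that unfolding I_def by (intro sigma_sets.Basic) auto
    then have "emeasure N {c<..d} = emeasure R {s c<..s d}"
      unfolding N_def using meas by (simp add: emeasure_distr spR pre that)
    also have "\<dots> = emeasure lborel {s c<..s d}"
      unfolding R_def using S pre[OF that(2,3)] by (intro emeasure_restrict_space) auto
    finally show ?thesis using sd by simp
  qed
  have setN: "sets ?M = sets N" by (simp add: N_def)
  show ?thesis
  proof (rule emeasure_extend_measure_Pair[OF stieltjes_def, where \<mu>'="emeasure N"])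
    show "positive (sets ?M) (emeasure N)" unfolding setN by (rule emeasure_positive)
    show "countably_additive (sets ?M) (emeasure N)" unfolding setN by (rule emeasure_countably_additive)
    show "{i<..j} \<in> Pow I" if "i \<le> j \<and> i \<in> I \<and> j \<in> I" for i j
      using sub[of i j] that by auto
  qed (use cd val in auto)
qed

definition is_scale_derivative :: "real set \<Rightarrow> (real \<Rightarrow> real) \<Rightarrow> (real \<Rightarrow> real) \<Rightarrow> (real \<Rightarrow> real) \<Rightarrow> bool" where
  "is_scale_derivative I s u v \<longleftrightarrow>
     v \<in> borel_measurable (stieltjes I s) \<and>
     (\<forall>x\<in>I. \<forall>y\<in>I. x < y \<longrightarrow>
        interval_lebesgue_integrable (stieltjes I s) (ereal x) (ereal y) v \<and>
        u y - u x = (LINT z=ereal x..ereal y|stieltjes I s. v z))"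

definition scale_abs_continuous :: "real set \<Rightarrow> (real \<Rightarrow> real) \<Rightarrow> (real \<Rightarrow> real) \<Rightarrow> bool" where
  "scale_abs_continuous I s u \<longleftrightarrow> (\<exists>v. is_scale_derivative I s u v)"

text \<open>The derivative is determined up to null sets of \<^term>\<open>stieltjes I s\<close>.\<close>

definition scale_derivative :: "real set \<Rightarrow> (real \<Rightarrow> real) \<Rightarrow> (real \<Rightarrow> real) \<Rightarrow> real \<Rightarrow> real" where
  "scale_derivative I s u = (SOME v. is_scale_derivative I s u v)"

definition form_domain :: "real set \<Rightarrow> (real \<Rightarrow> real) \<Rightarrow> real measure \<Rightarrow> (real \<Rightarrow> real) set" where
  "form_domain I s m =
     {u \<in> L2 m. scale_abs_continuous I s u \<and> scale_derivative I s u \<in> L2 (stieltjes I s)}"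

definition energy :: "real set \<Rightarrow> (real \<Rightarrow> real) \<Rightarrow> (real \<Rightarrow> real) \<Rightarrow> (real \<Rightarrow> real) \<Rightarrow> real" where
  "energy I s u v =
     1 / 2 * (LINT x|stieltjes I s. scale_derivative I s u x * scale_derivative I s v x)"

definition fat_sets :: "real set \<Rightarrow> (real \<Rightarrow> real) \<Rightarrow> real set set" where
  "fat_sets I s = {G \<in> sets (stieltjes I s).
     \<forall>c\<in>I. \<forall>d\<in>I. c < d \<longrightarrow> 0 < emeasure (stieltjes I s) (G \<inter> {c<..<d})}"

definition associated_scale :: "real set \<Rightarrow> (real \<Rightarrow> real) \<Rightarrow> real \<Rightarrow> real set \<Rightarrow> real \<Rightarrow> real" where
  "associated_scale I s e G x = (LINT z=ereal e..ereal x|stieltjes I s. indicator G z)"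

definition restricted_domain ::
    "real set \<Rightarrow> (real \<Rightarrow> real) \<Rightarrow> real measure \<Rightarrow> real set \<Rightarrow> (real \<Rightarrow> real) set" where
  "restricted_domain I s m F =
     {u \<in> form_domain I s m. AE x in stieltjes I s. x \<in> F \<longrightarrow> scale_derivative I s u x = 0}"

end

theory Submission
  imports Defs
begin

text \<open>
  Since \<open>ds\<^sub>n = 1\<^bsub>G\<^sub>n\<^esub> ds\<close>, the \<open>n\<close>-th form is the energy of \<open>s\<close> restricted to the functions whose
  \<open>s\<close>-derivative vanishes off \<open>G\<^sub>n\<close>. These domains decrease to the domain of the limit form, so the
  extended energies increase with \<open>n\<close>: constant sequences are recovery sequences, and the lower bound
  reduces to weak lower semicontinuity of the energy on each fixed domain. For the latter, choose almost
  energy minimal elements of the midpoint hulls of the tails of the sequence. By the parallelogram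
  identity their derivatives are Cauchy in \<open>L\<^sup>2(ds)\<close>. Integrating the limit of the derivatives gives a
  function that is continuous, and testing against indicators of bounded sets identifies it with the weak
  limit almost everywhere. No weak compactness or boundedness in \<open>L\<^sup>2(m)\<close> is needed, and the
  same identification yields closedness of the forms.
\<close>

section \<open>Square integrable functions\<close>

text \<open>The intersection of the sets may fail to be fat, and then integrating its indicator
  yields no scaling function; this is why all forms are compared inside the energy of the fixed
  scale \<open>s\<close>. Midpoints suffice because the parallelogram identity bounds the distance
  of two near minimizers by the excess of their energies over that of their midpoint. The minimal
  energies over the tails increase and stay bounded, so this excess tends to zero. The energy does
  not see additive constants, so convergence of the derivatives leaves open a drift of the
  functions; testing on one interval of positive \<open>m\<close>-measure excludes it. Forms are
  given on functions, while \<open>L2\<close> convergence sees classes. A function with square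
  integrable derivative is Hoelder continuous of order 1/2 with respect to \<open>s\<close>, and
  full support of \<open>m\<close> makes the values on \<open>I\<close> of such a representative
  unique. Hence the limits obtained separately in each of the decreasing domains are one function,
  which lies in all of them.\<close>

lemma L2_measurable [measurable_dest]: "f \<in> L2 M \<Longrightarrow> f \<in> borel_measurable M"
  by (simp add: L2_def)

lemma L2_integrable_square: "f \<in> L2 M \<Longrightarrow> integrable M (\<lambda>x. (f x)\<^sup>2)"
  by (simp add: L2_def)

lemma L2_integrable_mult:
  assumes f: "f \<in> L2 M" and g: "g \<in> L2 M"
  shows "integrable M (\<lambda>x. f x * g x)"
proof (rule Bochner_Integration.integrable_bound)
  show "integrable M (\<lambda>x. (f x)\<^sup>2 + (g x)\<^sup>2)"
    using f g by (intro Bochner_Integration.integrable_add L2_integrable_square)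
  show "(\<lambda>x. f x * g x) \<in> borel_measurable M"
    using f g by measurable
  have "\<bar>p * q\<bar> \<le> p\<^sup>2 + q\<^sup>2" for p q :: real
  proof -
    have "2 * \<bar>p * q\<bar> \<le> p\<^sup>2 + q\<^sup>2"
      using sum_squares_bound[of "\<bar>p\<bar>" "\<bar>q\<bar>"] by (simp add: abs_mult)
    then show ?thesis by linarith
  qed
  then show "AE x in M. norm (f x * g x) \<le> norm ((f x)\<^sup>2 + (g x)\<^sup>2)"
    by (intro AE_I2) simp
qed

lemma L2_lincomb:
  assumes f: "f \<in> L2 M" and g: "g \<in> L2 M"
  shows "(\<lambda>x. p * f x + q * g x) \<in> L2 M"
proof -
  have "integrable M (\<lambda>x. p\<^sup>2 * (f x)\<^sup>2 + (2 * p * q) * (f x * g x) + q\<^sup>2 * (g x)\<^sup>2)"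
    using f g by (intro Bochner_Integration.integrable_add integrable_mult_right L2_integrable_square L2_integrable_mult)
  then have "integrable M (\<lambda>x. (p * f x + q * g x)\<^sup>2)"
    by (simp add: power2_eq_square algebra_simps)
  then show ?thesis
    using L2_measurable[OF f] L2_measurable[OF g] by (simp add: L2_def)
qed

lemma L2_diff: "f \<in> L2 M \<Longrightarrow> g \<in> L2 M \<Longrightarrow> (\<lambda>x. f x - g x) \<in> L2 M"
  using L2_lincomb[of f M g 1 "-1"] by simp

lemma L2_zero: "(\<lambda>x. 0) \<in> L2 M"
  by (simp add: L2_def)

lemma L2_cong_AE:
  assumes "f \<in> L2 M" "g \<in> borel_measurable M" "AE x in M. f x = g x"
  shows "g \<in> L2 M"
proof -
  have "integrable M (\<lambda>x. (f x)\<^sup>2) \<longleftrightarrow> integrable M (\<lambda>x. (g x)\<^sup>2)"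
    using assms by (intro integrable_cong_AE) (auto simp: L2_def)
  then show ?thesis using assms by (simp add: L2_def)
qed

lemma L2_indicator:
  assumes "A \<in> sets M" "emeasure M A < \<infinity>"
  shows "(indicator A :: _ \<Rightarrow> real) \<in> L2 M"
proof -
  have "(\<lambda>x. (indicator A x :: real)\<^sup>2) = indicator A"
    by (auto simp: fun_eq_iff indicator_def)
  then show ?thesis
    using assms by (simp add: L2_def)
qed

section \<open>Inner product identities and inequalities\<close>

lemma integral_square_lincomb:
  assumes f: "f \<in> L2 M" and g: "g \<in> L2 M"
  shows "(LINT x|M. (p * f x + q * g x)\<^sup>2) =
    p\<^sup>2 * (LINT x|M. (f x)\<^sup>2) + 2 * p * q * (LINT x|M. f x * g x) + q\<^sup>2 * (LINT x|M. (g x)\<^sup>2)"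
proof -
  have "(LINT x|M. (p * f x + q * g x)\<^sup>2) =
      (LINT x|M. p\<^sup>2 * (f x)\<^sup>2 + (2 * p * q) * (f x * g x) + q\<^sup>2 * (g x)\<^sup>2)"
    by (intro Bochner_Integration.integral_cong) (auto simp: power2_eq_square algebra_simps)
  also have "\<dots> = p\<^sup>2 * (LINT x|M. (f x)\<^sup>2) + 2 * p * q * (LINT x|M. f x * g x) + q\<^sup>2 * (LINT x|M. (g x)\<^sup>2)"
    using f g
    by (subst Bochner_Integration.integral_add)
       (auto intro!: Bochner_Integration.integrable_add integrable_mult_right L2_integrable_square L2_integrable_mult
             simp: L2_integrable_square L2_integrable_mult)
  finally show ?thesis .
qed

lemma L2_Cauchy_Schwarz:
  assumes f: "f \<in> L2 M" and g: "g \<in> L2 M"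
  shows "(LINT x|M. f x * g x)\<^sup>2 \<le> (LINT x|M. (f x)\<^sup>2) * (LINT x|M. (g x)\<^sup>2)"
proof -
  define A B C where "A = (LINT x|M. (f x)\<^sup>2)" and "B = (LINT x|M. f x * g x)" and "C = (LINT x|M. (g x)\<^sup>2)"
  have "0 \<le> p\<^sup>2 * A + 2 * p * q * B + q\<^sup>2 * C" for p q
    unfolding A_def B_def C_def integral_square_lincomb[OF f g, symmetric] by simp
  \<comment> \<open>For \<open>p = C > 0\<close> the quadratic form is smallest at
    \<open>q = - B\<close>.\<close>
  from this[of C "-B"] have *: "0 \<le> C * (A * C - B\<^sup>2)"
    by (simp add: power2_eq_square algebra_simps)
  show ?thesis
  proof (cases "C = 0")
    case True
    then have "AE x in M. (g x)\<^sup>2 = 0"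
      using integral_nonneg_eq_0_iff_AE[OF L2_integrable_square[OF g]] by (simp add: C_def)
    then have "B = (LINT x|M. 0)"
      unfolding B_def using f g by (intro integral_cong_AE) (auto dest: L2_measurable)
    then show ?thesis
      by (fold A_def B_def C_def) (simp add: True)
  next
    case False
    moreover have "0 \<le> C" by (simp add: C_def)
    ultimately show ?thesis
      using * by (fold A_def B_def C_def) (simp add: zero_le_mult_iff)
  qed
qed

lemma L2_set_integrable:
  assumes f: "f \<in> L2 M" and A: "A \<in> sets M" "emeasure M A < \<infinity>"
  shows "set_integrable M A f"
  using L2_integrable_mult[OF L2_indicator[OF A] f] by (simp add: set_integrable_def)

lemma L2_set_integral_le:
  assumes f: "f \<in> L2 M" and A: "A \<in> sets M" "emeasure M A < \<infinity>"
  shows "(LINT x:A|M. f x)\<^sup>2 \<le> (LINT x|M. (f x)\<^sup>2) * measure M A"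
proof -
  have "(\<lambda>x. (indicator A x :: real)\<^sup>2) = indicator A"
    by (auto simp: fun_eq_iff indicator_def)
  moreover have "A \<inter> space M = A" using sets.sets_into_space[OF A(1)] by blast
  ultimately show ?thesis
    using L2_Cauchy_Schwarz[OF f L2_indicator[OF A]]
    by (simp add: set_lebesgue_integral_def mult.commute)
qed

section \<open>Fatou's lemma, completeness and limits of norms\<close>

lemma nn_integral_square_L2:
  "f \<in> L2 M \<Longrightarrow> (\<integral>\<^sup>+x. ennreal ((f x)\<^sup>2) \<partial>M) = ennreal (LINT x|M. (f x)\<^sup>2)"
  by (intro nn_integral_eq_integral L2_integrable_square) auto

text \<open>Square integrability of \<open>h\<close> is part of the claim, so the estimate is made
  with integrals in \<open>ennreal\<close>, and integrability is read off from finiteness.\<close>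

lemma L2_Fatou:
  assumes g: "\<And>i. g i \<in> L2 M" and h[measurable]: "h \<in> borel_measurable M"
    and lim: "AE x in M. (\<lambda>i. g i x) \<longlonglongrightarrow> h x"
    and bound: "eventually (\<lambda>i. (LINT x|M. (g i x)\<^sup>2) \<le> C) sequentially"
  shows "h \<in> L2 M" "(LINT x|M. (h x)\<^sup>2) \<le> C"
proof -
  note [measurable] = L2_measurable[OF g]
  \<comment> \<open>\<open>ennreal\<close> sends negative reals to 0, so the return from
    \<open>ennreal C\<close> to \<open>C\<close> at the end depends on this.\<close>
  have C: "0 \<le> C"
  proof -
    obtain i where "(LINT x|M. (g i x)\<^sup>2) \<le> C"
      using bound by (auto simp: eventually_sequentially)
    moreover have "0 \<le> (LINT x|M. (g i x)\<^sup>2)" by simp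
    ultimately show ?thesis by (rule order_trans[rotated])
  qed
  have "(\<integral>\<^sup>+x. ennreal ((h x)\<^sup>2) \<partial>M) = (\<integral>\<^sup>+x. liminf (\<lambda>i. ennreal ((g i x)\<^sup>2)) \<partial>M)"
  proof (intro nn_integral_cong_AE, use lim in eventually_elim)
    case (elim x)
    then have "(\<lambda>i. ennreal ((g i x)\<^sup>2)) \<longlonglongrightarrow> ennreal ((h x)\<^sup>2)"
      by (intro tendsto_ennrealI tendsto_power)
    then show ?case
      by (rule lim_imp_Liminf[OF sequentially_bot, symmetric])
  qed
  also have "\<dots> \<le> liminf (\<lambda>i. \<integral>\<^sup>+x. ennreal ((g i x)\<^sup>2) \<partial>M)"
    by (intro nn_integral_liminf) measurable
  also have "\<dots> \<le> liminf (\<lambda>i. ennreal C)"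
    using bound by (intro Liminf_mono) (auto simp: nn_integral_square_L2[OF g] ennreal_leI elim!: eventually_mono)
  finally have *: "(\<integral>\<^sup>+x. ennreal ((h x)\<^sup>2) \<partial>M) \<le> ennreal C"
    by (simp add: Liminf_const)
  then have "integrable M (\<lambda>x. (h x)\<^sup>2)"
    by (intro integrableI_bounded) (auto simp: le_less_trans)
  then show "h \<in> L2 M" by (simp add: L2_def)
  from * show "(LINT x|M. (h x)\<^sup>2) \<le> C"
    by (simp add: nn_integral_square_L2[OF \<open>h \<in> L2 M\<close>] C)
qed

text \<open>Riesz-Fischer: along a fast subsequence a weighted series of squared increments has
  finite integral, so the increments are absolutely summable almost everywhere; Fatou's lemma turns
  the pointwise limit into a limit in \<open>L2\<close>.\<close>

lemma L2_complete:
  assumes f: "\<And>n. f n \<in> L2 M"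
    and Cauchy: "\<And>\<epsilon>. 0 < \<epsilon> \<Longrightarrow> \<exists>N. \<forall>k\<ge>N. \<forall>l\<ge>N. (LINT x|M. (f k x - f l x)\<^sup>2) < \<epsilon>"
  obtains g where "g \<in> L2 M" "(\<lambda>n. LINT x|M. (f n x - g x)\<^sup>2) \<longlonglongrightarrow> 0"
proof -
  note [measurable] = L2_measurable[OF f]
  \<comment> \<open>The rate 1/8 leaves room for the weight \<open>2 ^ i\<close>: the weighted
    series is dominated by that of \<open>(1/4) ^ i\<close>.\<close>
  define P where "P i N \<longleftrightarrow> (\<forall>k\<ge>N. \<forall>l\<ge>N. (LINT x|M. (f k x - f l x)\<^sup>2) < (1/8) ^ i)" for i :: nat and N :: nat
  have "\<forall>i. \<exists>N. P i N" unfolding P_def by (intro allI Cauchy) simp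
  then obtain N where N: "\<And>i. P i (N i)" by metis
  \<comment> \<open>The maximum puts both \<open>r i\<close> and \<open>r (Suc i)\<close> beyond
    \<open>N i\<close>; the summand \<open>i\<close> drives \<open>r\<close> to infinity.\<close>
  define r where "r i = Max (N ` {..i}) + i" for i
  have r_ge: "N i \<le> r j" if "i \<le> j" for i j
    using that unfolding r_def by (intro trans_le_add1 Max_ge) auto
  have id_r: "i \<le> r i" for i by (simp add: r_def)
  define d where "d i x = f (r (Suc i)) x - f (r i) x" for i x
  have d: "d i \<in> L2 M" for i unfolding d_def by (intro L2_diff f)
  note [measurable] = L2_measurable[OF d]
  have dint: "(LINT x|M. (d i x)\<^sup>2) \<le> (1/8) ^ i" for i
    using N[of i] r_ge[of i i] r_ge[of i "Suc i"] unfolding P_def d_def by (simp add: less_imp_le)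
  have "(\<integral>\<^sup>+x. (\<Sum>i. ennreal (2 ^ i * (d i x)\<^sup>2)) \<partial>M) = (\<Sum>i. \<integral>\<^sup>+x. ennreal (2 ^ i * (d i x)\<^sup>2) \<partial>M)"
    by (intro nn_integral_suminf) measurable
  also have "\<dots> \<le> (\<Sum>i. ennreal ((1/4) ^ i))"
  proof (intro suminf_le)
    fix i
    have "(\<integral>\<^sup>+x. ennreal (2 ^ i * (d i x)\<^sup>2) \<partial>M) = 2 ^ i * ennreal (LINT x|M. (d i x)\<^sup>2)"
      by (simp add: ennreal_mult nn_integral_cmult nn_integral_square_L2[OF d] ennreal_power[symmetric])
    also have "\<dots> = ennreal (2 ^ i * (LINT x|M. (d i x)\<^sup>2))"
      by (simp add: ennreal_mult ennreal_power[symmetric])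
    also have "\<dots> \<le> ennreal (2 ^ i * (1/8) ^ i)"
      using dint by (intro ennreal_leI mult_left_mono) auto
    also have "2 ^ i * (1/8) ^ i = (1/4 :: real) ^ i"
      by (simp add: power_mult_distrib[symmetric])
    finally show "(\<integral>\<^sup>+x. ennreal (2 ^ i * (d i x)\<^sup>2) \<partial>M) \<le> ennreal ((1/4) ^ i)" .
  qed auto
  also have "\<dots> < \<infinity>"
    by (subst suminf_ennreal2) (auto simp: summable_geometric)
  finally have "AE x in M. (\<Sum>i. ennreal (2 ^ i * (d i x)\<^sup>2)) \<noteq> \<infinity>"
    by (intro nn_integral_PInf_AE) auto
  then have AE_conv: "AE x in M. convergent (\<lambda>i. f (r i) x)"
  proof eventually_elim
    case (elim x)
    then have "summable (\<lambda>i. 2 ^ i * (d i x)\<^sup>2)"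
      by (intro summable_suminf_not_top) auto
    then have "summable (\<lambda>i. (1/2) ^ i + 2 ^ i * (d i x)\<^sup>2)"
      by (intro summable_add summable_geometric) auto
    then have "summable (\<lambda>i. d i x)"
    proof (rule summable_comparison_test')
      fix i
      \<comment> \<open>The weight lets squares control first powers: expand the square of
        \<open>1 - 2 ^ i * \<bar>d i x\<bar>\<close>, scaled by \<open>(1/2) ^ i\<close>.\<close>
      have "2 * \<bar>d i x\<bar> \<le> (1/2) ^ i + 2 ^ i * (d i x)\<^sup>2"
      proof -
        have "0 \<le> (1/2) ^ i * (1 - 2 ^ i * \<bar>d i x\<bar>)\<^sup>2" by simp
        also have "\<dots> = ((1/2) ^ i) - 2 * ((1/2) ^ i * 2 ^ i) * \<bar>d i x\<bar> + ((1/2) ^ i * 2 ^ i) * 2 ^ i * \<bar>d i x\<bar>\<^sup>2"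
          by (simp add: power2_eq_square algebra_simps)
        also have "(1/2) ^ i * 2 ^ i = (1 :: real)"
          by (simp add: power_mult_distrib[symmetric])
        finally show ?thesis by simp
      qed
      then show "norm (d i x) \<le> (1/2) ^ i + 2 ^ i * (d i x)\<^sup>2"
        using abs_ge_zero[of "d i x"] unfolding real_norm_def by linarith
    qed
    then have "convergent (\<lambda>n. \<Sum>i<n. d i x)"
      by (simp add: summable_iff_convergent)
    then have "convergent (\<lambda>n. (\<Sum>i<n. d i x) + f (r 0) x)"
      by (intro convergent_add convergent_const)
    moreover have "(\<Sum>i<n. d i x) + f (r 0) x = f (r n) x" for n
      unfolding d_def by (subst sum_lessThan_telescope) simp
    ultimately show ?case by simp
  qed
  define g where "g x = lim (\<lambda>i. f (r i) x)" for x
  have [measurable]: "g \<in> borel_measurable M" unfolding g_def by measurable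
  have lim: "AE x in M. (\<lambda>i. f (r i) x) \<longlonglongrightarrow> g x"
    using AE_conv by eventually_elim (simp add: g_def convergent_LIMSEQ_iff)
  \<comment> \<open>Fatou's lemma in the second index: the Cauchy bound for
    \<open>f n - f (r i)\<close> survives the limit in \<open>i\<close>.\<close>
  have key: "(\<lambda>x. f n x - g x) \<in> L2 M \<and> (LINT x|M. (f n x - g x)\<^sup>2) \<le> \<epsilon>"
    if K: "\<forall>k\<ge>K. \<forall>l\<ge>K. (LINT x|M. (f k x - f l x)\<^sup>2) < \<epsilon>" and "K \<le> n" for n K \<epsilon>
  proof -
    have "eventually (\<lambda>i. (LINT x|M. (f n x - f (r i) x)\<^sup>2) \<le> \<epsilon>) sequentially"
      unfolding eventually_sequentially using K \<open>K \<le> n\<close> id_r by (meson less_imp_le order_trans)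
    moreover have "AE x in M. (\<lambda>i. f n x - f (r i) x) \<longlonglongrightarrow> f n x - g x"
      using lim by eventually_elim (intro tendsto_intros)
    ultimately show ?thesis
      using L2_Fatou[of "\<lambda>i x. f n x - f (r i) x" M "\<lambda>x. f n x - g x" \<epsilon>] L2_diff[OF f f] by auto
  qed
  obtain K where "\<forall>k\<ge>K. \<forall>l\<ge>K. (LINT x|M. (f k x - f l x)\<^sup>2) < 1"
    using Cauchy[of 1] by auto
  from L2_diff[OF f[of K] conjunct1[OF key[OF this order_refl]]] have "g \<in> L2 M" by simp
  moreover have "(\<lambda>n. LINT x|M. (f n x - g x)\<^sup>2) \<longlonglongrightarrow> 0"
  proof (rule LIMSEQ_I)
    fix \<epsilon> :: real assume "0 < \<epsilon>"
    then obtain K where K: "\<forall>k\<ge>K. \<forall>l\<ge>K. (LINT x|M. (f k x - f l x)\<^sup>2) < \<epsilon> / 2"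
      using Cauchy[of "\<epsilon> / 2"] by auto
    show "\<exists>no. \<forall>n\<ge>no. norm ((LINT x|M. (f n x - g x)\<^sup>2) - 0) < \<epsilon>"
    proof (intro exI allI impI)
      fix n assume "K \<le> n"
      from key[OF K this] \<open>0 < \<epsilon>\<close> show "norm ((LINT x|M. (f n x - g x)\<^sup>2) - 0) < \<epsilon>" by simp
    qed
  qed
  ultimately show ?thesis by (rule that)
qed

text \<open>In the expanded square of \<open>f n = (f n - g) + g\<close> the square of the
  difference is dropped, and the cross term vanishes in the limit by Cauchy-Schwarz.\<close>

lemma L2_norm_limit_le:
  assumes f: "\<And>n. f n \<in> L2 M" and g: "g \<in> L2 M"
    and lim: "(\<lambda>n. LINT x|M. (f n x - g x)\<^sup>2) \<longlonglongrightarrow> 0"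
    and c: "\<And>n. (LINT x|M. (f n x)\<^sup>2) \<le> c n" "c \<longlonglongrightarrow> C"
  shows "(LINT x|M. (g x)\<^sup>2) \<le> C"
proof -
  define A where "A = (LINT x|M. (g x)\<^sup>2)"
  have [simp]: "0 \<le> A" by (simp add: A_def)
  have "A \<le> c n - 2 * (LINT x|M. (f n x - g x) * g x)" for n
  proof -
    have "f n = (\<lambda>x. 1 * (f n x - g x) + 1 * g x)" by simp
    then have "(LINT x|M. (f n x)\<^sup>2) = (LINT x|M. (1 * (f n x - g x) + 1 * g x)\<^sup>2)"
      by simp
    also have "\<dots> = (LINT x|M. (f n x - g x)\<^sup>2) + 2 * (LINT x|M. (f n x - g x) * g x) + A"
      using integral_square_lincomb[OF L2_diff[OF f[of n] g] g, of 1 1] by (simp add: A_def)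
    finally have "2 * (LINT x|M. (f n x - g x) * g x) + A \<le> (LINT x|M. (f n x)\<^sup>2)"
      by simp
    with c(1)[of n] show ?thesis by linarith
  qed
  moreover have "(\<lambda>n. LINT x|M. (f n x - g x) * g x) \<longlonglongrightarrow> 0"
  proof (rule tendsto_rabs_zero_cancel, rule tendsto_sandwich[OF always_eventually always_eventually])
    show "\<forall>n. 0 \<le> \<bar>LINT x|M. (f n x - g x) * g x\<bar>" by simp
    show "\<forall>n. \<bar>LINT x|M. (f n x - g x) * g x\<bar> \<le> sqrt ((LINT x|M. (f n x - g x)\<^sup>2) * A)"
      unfolding A_def by (intro allI real_le_rsqrt) (simp add: L2_Cauchy_Schwarz[OF L2_diff[OF f g] g])
    show "(\<lambda>n. sqrt ((LINT x|M. (f n x - g x)\<^sup>2) * A)) \<longlonglongrightarrow> 0"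
      using tendsto_real_sqrt[OF tendsto_mult[OF lim tendsto_const[of A]]] by simp
  qed simp
  then have "(\<lambda>n. c n - 2 * (LINT x|M. (f n x - g x) * g x)) \<longlonglongrightarrow> C - 2 * 0"
    by (intro tendsto_intros c)
  ultimately show ?thesis
    unfolding A_def[symmetric] by (intro LIMSEQ_le_const[where a = A and x = C]) auto
qed

section \<open>Minimizing sequences under the parallelogram identity\<close>

text \<open>For the square \<open>Q\<close> of a Hilbert seminorm and midpoints \<open>mid\<close>, the quantity shown to be small
  is the squared distance, by the parallelogram identity.\<close>
lemma near_minimizers_Cauchy:
  fixes K :: "nat \<Rightarrow> 'c set" and Q :: "'c \<Rightarrow> real" and mid :: "'c \<Rightarrow> 'c \<Rightarrow> 'c"
  assumes dec: "\<And>i j. i \<le> j \<Longrightarrow> K j \<subseteq> K i"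
    and mid: "\<And>n f g. f \<in> K n \<Longrightarrow> g \<in> K n \<Longrightarrow> mid f g \<in> K n"
    and Q: "\<And>f. f \<in> K 0 \<Longrightarrow> 0 \<le> Q f"
    and C: "\<And>n. \<exists>f\<in>K n. Q f \<le> C"
  obtains f where "\<And>n. f n \<in> K n" "\<And>n. Q (f n) \<le> C + 1 / real (Suc n)"
    "\<And>\<epsilon>. 0 < \<epsilon> \<Longrightarrow> \<exists>N. \<forall>k\<ge>N. \<forall>l\<ge>N. 2 * Q (f k) + 2 * Q (f l) - 4 * Q (mid (f k) (f l)) < \<epsilon>"
proof -
  \<comment> \<open>Shrinking \<open>K\<close> raises the infimum, which stays below
    \<open>C\<close>; its convergence is what forces near minimizers together.\<close>
  define d where "d n = Inf (Q ` K n)" for n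
  have ne: "K n \<noteq> {}" for n using C[of n] by blast
  have bdd: "bdd_below (Q ` K n)" for n
    using dec[of 0 n] Q by (intro bdd_belowI[of _ 0]) auto
  have d_le: "d n \<le> Q f" if "f \<in> K n" for n f
    unfolding d_def using that bdd by (intro cINF_lower)
  have d_C: "d n \<le> C" for n
    using C[of n] d_le by (meson order_trans)
  have "incseq d"
    unfolding d_def using dec ne bdd by (intro monoI cINF_superset_mono) auto
  moreover have "bdd_above (range d)"
    using d_C by (intro bdd_aboveI[of _ C]) auto
  ultimately have lim: "d \<longlonglongrightarrow> (SUP i. d i)"
    by (intro LIMSEQ_incseq_SUP)
  have "\<exists>f. f \<in> K n \<and> Q f < d n + 1 / real (Suc n)" for n
  proof -
    have "Inf (Q ` K n) < d n + 1 / real (Suc n)" by (simp add: d_def)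
    then show ?thesis using cINF_less_iff[OF ne bdd] by blast
  qed
  then obtain f where f: "\<And>n. f n \<in> K n" "\<And>n. Q (f n) < d n + 1 / real (Suc n)" by metis
  show ?thesis
  proof (rule that)
    show "f n \<in> K n" "Q (f n) \<le> C + 1 / real (Suc n)" for n
      using f(1)[of n] f(2)[of n] d_C[of n] by simp_all
    fix \<epsilon> :: real assume "0 < \<epsilon>"
    have "(\<lambda>n. d n + 1 / real (Suc n)) \<longlonglongrightarrow> (SUP i. d i) + 0"
      by (intro tendsto_add lim LIMSEQ_Suc lim_1_over_n)
    \<comment> \<open>Both deviations enter the final estimate with total weight 4, hence
      \<open>\<epsilon> / 8\<close>.\<close>
    then have "eventually (\<lambda>n. d n + 1 / real (Suc n) < (SUP i. d i) + \<epsilon> / 8 \<and> (SUP i. d i) - \<epsilon> / 8 < d n) sequentially"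
      using \<open>0 < \<epsilon>\<close> lim by (intro eventually_conj order_tendstoD) auto
    then obtain N where N: "\<And>n. N \<le> n \<Longrightarrow> d n + 1 / real (Suc n) < (SUP i. d i) + \<epsilon> / 8"
      "(SUP i. d i) - \<epsilon> / 8 < d N"
      by (auto simp: eventually_sequentially)
    show "\<exists>N. \<forall>k\<ge>N. \<forall>l\<ge>N. 2 * Q (f k) + 2 * Q (f l) - 4 * Q (mid (f k) (f l)) < \<epsilon>"
    proof (intro exI allI impI)
      fix k l assume kl: "N \<le> k" "N \<le> l"
      \<comment> \<open>\<open>K N\<close> contains both near minimizers, so their midpoint is
        compared with \<open>d N\<close>.\<close>
      have "mid (f k) (f l) \<in> K N"
        using f(1) dec kl by (intro mid) blast+
      then have "d N \<le> Q (mid (f k) (f l))" by (rule d_le)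
      then show "2 * Q (f k) + 2 * Q (f l) - 4 * Q (mid (f k) (f l)) < \<epsilon>"
        using N(1)[OF kl(1)] N(1)[OF kl(2)] N(2) f(2)[of k] f(2)[of l] by linarith
    qed
  qed
qed

section \<open>Scale derivatives\<close>

locale interval_scale =
  fixes a b :: ereal and I :: "real set" and s :: "real \<Rightarrow> real"
  assumes I_eq: "I = einterval a b"
    and scaling: "scaling_function I s"
begin

abbreviation M :: "real measure" where "M \<equiv> stieltjes I s"

section \<open>The Stieltjes measure: intervals, Borel sets, absence of atoms\<close>

lemma scale_less: "x \<in> I \<Longrightarrow> y \<in> I \<Longrightarrow> x < y \<Longrightarrow> s x < s y"
  using scaling by (auto simp: scaling_function_def strict_mono_on_def)

lemma scale_le: "x \<in> I \<Longrightarrow> y \<in> I \<Longrightarrow> x \<le> y \<Longrightarrow> s x \<le> s y"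
  using scale_less[of x y] by (cases "x = y") auto

lemma open_I: "open I"
  by (simp add: I_eq)

lemma Icc_subset: "c \<in> I \<Longrightarrow> d \<in> I \<Longrightarrow> {c..d} \<subseteq> I"
  unfolding I_eq einterval_def
  by (auto, (metis ereal_less_eq(3) less_le_trans), (metis ereal_less_eq(3) le_less_trans))

lemma Ioc_subset: "c \<in> I \<Longrightarrow> d \<in> I \<Longrightarrow> {c<..d} \<subseteq> I"
  using Icc_subset[of c d] by force

lemma space_M: "space M = I"
  unfolding I_eq by (rule space_stieltjes)

lemma emeasure_Ioc: "c \<in> I \<Longrightarrow> d \<in> I \<Longrightarrow> c \<le> d \<Longrightarrow> emeasure M {c<..d} = ennreal (s d - s c)"
  using emeasure_stieltjes_Ioc[of a b s c d] scaling unfolding I_eq by blast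

lemma measure_Ioc: "c \<in> I \<Longrightarrow> d \<in> I \<Longrightarrow> c \<le> d \<Longrightarrow> measure M {c<..d} = s d - s c"
  using scale_le[of c d] by (simp add: measure_def emeasure_Ioc)

lemma sets_Ioc: "c \<in> I \<Longrightarrow> d \<in> I \<Longrightarrow> {c<..d} \<in> sets M"
proof (cases "c \<le> d")
  case True
  assume "c \<in> I" "d \<in> I"
  then show ?thesis
    using True unfolding I_eq sets_stieltjes by (intro sigma_sets.Basic) auto
qed simp

text \<open>Rational end points give countability. The closed interval is asked to lie in
  \<open>J\<close> so that, for \<open>J \<subseteq> I\<close>, both end points belong to
  \<open>I\<close> and each piece is a generator of \<open>M\<close> of finite mass.\<close>

definition Ioc_cover :: "real set \<Rightarrow> (real \<times> real) set" where
  "Ioc_cover J = {(c, d). c \<in> \<rat> \<and> d \<in> \<rat> \<and> c < d \<and> {c..d} \<subseteq> J}"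

lemma countable_Ioc_cover: "countable (Ioc_cover J)"
  by (rule countable_subset[of _ "\<rat> \<times> \<rat>"]) (auto simp: Ioc_cover_def countable_rat)

lemma Union_Ioc_cover:
  assumes "open J"
  shows "(\<Union>(c, d)\<in>Ioc_cover J. {c<..d}) = J"
proof (intro equalityI subsetI)
  fix x assume "x \<in> J"
  with assms obtain r where r: "r > 0" "ball x r \<subseteq> J"
    by (auto simp: open_contains_ball)
  obtain c d where c: "c \<in> \<rat>" "x - r < c" "c < x" and d: "d \<in> \<rat>" "x < d" "d < x + r"
    using Rats_dense_in_real[of "x - r" x] Rats_dense_in_real[of x "x + r"] r by auto
  have "{c..d} \<subseteq> ball x r"
    using c d by (auto simp: dist_real_def)
  then have "(c, d) \<in> Ioc_cover J" using c d r by (auto simp: Ioc_cover_def)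
  then show "x \<in> (\<Union>(c, d)\<in>Ioc_cover J. {c<..d})" using c d by (intro UN_I) auto
qed (auto simp: Ioc_cover_def subset_iff)

lemma Ioc_coverD: "(c, d) \<in> Ioc_cover J \<Longrightarrow> J \<subseteq> I \<Longrightarrow> c \<in> I \<and> d \<in> I \<and> c < d"
  by (force simp: Ioc_cover_def)

text \<open>Half-open intervals are Borel; conversely an open subset of \<open>I\<close> is the
  countable union of its \<open>Ioc_cover\<close>. This puts \<open>M\<close> and \<open>m\<close>
  on the same sigma-algebra.\<close>

lemma sets_M: "sets M = sets (restrict_space borel I)"
proof
  show "sets M \<subseteq> sets (restrict_space borel I)"
    unfolding I_eq sets_stieltjes
  proof (intro sigma_algebra.sigma_sets_subset)
    show "sigma_algebra (einterval a b) (sets (restrict_space borel (einterval a b)))"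
      using sets.sigma_algebra_axioms[of "restrict_space borel (einterval a b)"]
      by (simp add: space_restrict_space)
    show "(\<lambda>(c, d). {c<..d}) ` {(c, d). c \<le> d \<and> c \<in> einterval a b \<and> d \<in> einterval a b}
        \<subseteq> sets (restrict_space borel (einterval a b))"
    proof clarify
      fix c d assume "c \<in> einterval a b" "d \<in> einterval a b"
      then have "{c<..d} \<subseteq> einterval a b" using Ioc_subset unfolding I_eq by blast
      then show "{c<..d} \<in> sets (restrict_space borel (einterval a b))"
        by (simp add: sets_restrict_space_iff)
    qed
  qed
  have "(\<lambda>x. x) \<in> measurable M borel"
  proof (rule borel_measurableI)
    fix S :: "real set" assume "open S"
    have J: "(\<lambda>x. x) -` S \<inter> space M = (\<Union>(c, d)\<in>Ioc_cover (S \<inter> I). {c<..d})"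
      using \<open>open S\<close> open_I by (subst Union_Ioc_cover) (auto simp: space_M)
    show "(\<lambda>x. x) -` S \<inter> space M \<in> sets M"
      unfolding J
    proof (intro sets.countable_UN'' countable_Ioc_cover)
      fix p assume "p \<in> Ioc_cover (S \<inter> I)"
      then show "(case p of (c, d) \<Rightarrow> {c<..d}) \<in> sets M"
        using Ioc_coverD[of "fst p" "snd p" "S \<inter> I"] by (auto simp: case_prod_beta intro!: sets_Ioc)
    qed
  qed
  then show "sets (restrict_space borel I) \<subseteq> sets M"
    by (auto simp: sets_restrict_space space_M dest!: measurable_sets[of _ M borel])
       (metis inf_commute vimage_ident)
qed

lemma sets_borel_subset: "A \<in> sets borel \<Longrightarrow> A \<subseteq> I \<Longrightarrow> A \<in> sets M"
  using open_I by (simp add: sets_M sets_restrict_space_iff)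

text \<open>Continuity of \<open>s\<close> excludes atoms: \<open>{y}\<close> lies in
  \<open>{c<..y}\<close>, whose mass \<open>s y - s c\<close> is small for \<open>c\<close> just
  left of \<open>y\<close>.\<close>

lemma AE_not_point:
  assumes y: "y \<in> I"
  shows "AE x in M. x \<noteq> y"
proof -
  have sets: "{y} \<in> sets M" using y by (intro sets_borel_subset) auto
  have "continuous (at y) s"
    using scaling y open_I by (simp add: scaling_function_def continuous_on_eq_continuous_at)
  have "emeasure M {y} \<le> 0"
  proof (rule ennreal_le_epsilon)
    fix \<epsilon> :: real assume "0 < \<epsilon>"
    with \<open>continuous (at y) s\<close> obtain r where r: "0 < r" "\<And>x. \<bar>x - y\<bar> < r \<Longrightarrow> \<bar>s x - s y\<bar> < \<epsilon>"
      unfolding continuous_at_eps_delta dist_real_def by blast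
    obtain r' where r': "0 < r'" "ball y r' \<subseteq> I"
      using open_I y by (auto simp: open_contains_ball)
    define c where "c = y - min r r' / 2"
    have c: "c < y" "\<bar>c - y\<bar> < r" "c \<in> ball y r'"
      using r(1) r'(1) by (auto simp: c_def dist_real_def min_def)
    then have "c \<in> I" using r' by blast
    have "emeasure M {y} \<le> emeasure M {c<..y}"
      using c y \<open>c \<in> I\<close> by (intro emeasure_mono sets_Ioc) auto
    also have "\<dots> = ennreal (s y - s c)" using \<open>c \<in> I\<close> y c by (intro emeasure_Ioc) auto
    also have "\<dots> \<le> ennreal \<epsilon>" using r(2)[OF c(2)] by (intro ennreal_leI) auto
    finally show "emeasure M {y} \<le> 0 + ennreal \<epsilon>" by simp
  qed
  then have "{y} \<in> null_sets M" using sets by auto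
  then show ?thesis by (auto dest: AE_not_in)
qed

text \<open>Countably many half-open intervals cover \<open>I\<close>, so the null sets can be
  merged. \<open>N\<close> is left general to serve both \<open>M\<close> and
  \<open>m\<close>.\<close>

lemma AE_local:
  assumes N: "space N \<subseteq> I"
    and P: "\<And>c d. c \<in> I \<Longrightarrow> d \<in> I \<Longrightarrow> c < d \<Longrightarrow> AE x in N. x \<in> {c<..d} \<longrightarrow> P x"
  shows "AE x in N. P x"
proof -
  have "AE x in N. \<forall>p\<in>Ioc_cover I. x \<in> {fst p<..snd p} \<longrightarrow> P x"
    using P Ioc_coverD[of _ _ I] by (intro AE_ball_countable[THEN iffD2] countable_Ioc_cover ballI) (auto simp: split_paired_all)
  then show ?thesis
  proof (rule AE_mp, intro AE_I2 impI)
    fix x assume "x \<in> space N" and *: "\<forall>p\<in>Ioc_cover I. x \<in> {fst p<..snd p} \<longrightarrow> P x"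
    then have "x \<in> (\<Union>(c, d)\<in>Ioc_cover I. {c<..d})"
      using N Union_Ioc_cover[OF open_I] by auto
    with * show "P x" by fastforce
  qed
qed

section \<open>Integrals over intervals and primitives\<close>

lemma einterval_sets: "x \<in> I \<Longrightarrow> y \<in> I \<Longrightarrow> einterval (ereal x) (ereal y) \<in> sets M"
  using Ioc_subset[of x y] by (intro sets_borel_subset) auto

text \<open>Oriented interval integrals run over open intervals, whereas \<open>M\<close> is
  described on half-open ones; the right end point carries no mass.\<close>

lemma set_integrable_Ioo_iff:
  fixes f :: "real \<Rightarrow> real"
  assumes [measurable]: "f \<in> borel_measurable M" and x: "x \<in> I" and y: "y \<in> I"
  shows "set_integrable M (einterval (ereal x) (ereal y)) f \<longleftrightarrow> set_integrable M {x<..y} f"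
    and "(LINT z:einterval (ereal x) (ereal y)|M. f z) = (LINT z:{x<..y}|M. f z)"
proof -
  note [measurable] = sets_Ioc[OF x y] einterval_sets[OF x y]
  have *: "AE z in M. indicator (einterval (ereal x) (ereal y)) z *\<^sub>R f z = indicator {x<..y} z *\<^sub>R f z"
    using AE_not_point[OF y] by eventually_elim (auto simp: indicator_def)
  then show "set_integrable M (einterval (ereal x) (ereal y)) f \<longleftrightarrow> set_integrable M {x<..y} f"
    unfolding set_integrable_def by (intro integrable_cong_AE) measurable
  from * show "(LINT z:einterval (ereal x) (ereal y)|M. f z) = (LINT z:{x<..y}|M. f z)"
    unfolding set_lebesgue_integral_def by (intro integral_cong_AE) measurable
qed

definition locally_integrable :: "(real \<Rightarrow> real) \<Rightarrow> bool" where
  "locally_integrable f \<longleftrightarrow> f \<in> borel_measurable M \<and> (\<forall>x\<in>I. \<forall>y\<in>I. x < y \<longrightarrow> set_integrable M {x<..y} f)"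

lemma locally_integrableD: "locally_integrable f \<Longrightarrow> x \<in> I \<Longrightarrow> y \<in> I \<Longrightarrow> set_integrable M {x<..y} f"
  by (cases "x < y") (auto simp: locally_integrable_def set_integrable_def)

lemma is_scale_derivative_iff:
  "is_scale_derivative I s u v \<longleftrightarrow>
    locally_integrable v \<and> (\<forall>x\<in>I. \<forall>y\<in>I. x < y \<longrightarrow> u y - u x = (LINT z:{x<..y}|M. v z))"
  unfolding is_scale_derivative_def locally_integrable_def interval_lebesgue_integrable_def
    interval_lebesgue_integral_def
  using set_integrable_Ioo_iff[of v] by (auto simp del: einterval_eq)

lemma set_integral_Ioc_add:
  assumes f: "locally_integrable f" and xyz: "x \<in> I" "y \<in> I" "z \<in> I" "x \<le> y" "y \<le> z"
  shows "(LINT t:{x<..z}|M. f t) = (LINT t:{x<..y}|M. f t) + (LINT t:{y<..z}|M. f t)"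
proof -
  have "{x<..z} = {x<..y} \<union> {y<..z}" using xyz by auto
  then show ?thesis
    using xyz by (simp only:) (intro set_integral_Un locally_integrableD[OF f], auto)
qed

lemma primitive_eq:
  assumes f: "locally_integrable f" and ex: "e \<in> I" "x \<in> I"
  shows "(LINT z=ereal e..ereal x|M. f z) =
    (if e \<le> x then (LINT z:{e<..x}|M. f z) else - (LINT z:{x<..e}|M. f z))"
proof -
  have "f \<in> borel_measurable M" using f by (simp add: locally_integrable_def)
  then show ?thesis
    unfolding interval_lebesgue_integral_def
    using set_integrable_Ioo_iff(2)[of f e x] set_integrable_Ioo_iff(2)[of f x e] ex
    by (auto simp del: einterval_eq)
qed

lemma primitive_diff:
  assumes f: "locally_integrable f" and exy: "e \<in> I" "x \<in> I" "y \<in> I" "x \<le> y"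
  shows "(LINT z=ereal e..ereal y|M. f z) - (LINT z=ereal e..ereal x|M. f z) = (LINT z:{x<..y}|M. f z)"
proof -
  consider "e \<le> x" | "x < e" "e \<le> y" | "y < e" by linarith
  then show ?thesis
  proof cases
    case 1
    then show ?thesis
      using exy set_integral_Ioc_add[OF f, of e x y] by (simp add: primitive_eq[OF f])
  next
    case 2
    then show ?thesis
      using exy set_integral_Ioc_add[OF f, of x e y] by (simp add: primitive_eq[OF f])
  next
    case 3
    then show ?thesis
      using exy set_integral_Ioc_add[OF f, of x y e] by (simp add: primitive_eq[OF f])
  qed
qed

lemma L2_locally_integrable:
  assumes "f \<in> L2 M"
  shows "locally_integrable f"
  unfolding locally_integrable_def
  using assms by (auto intro!: L2_set_integrable sets_Ioc L2_measurable simp: emeasure_Ioc)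

lemma is_scale_derivative_primitive:
  assumes f: "locally_integrable f" and e: "e \<in> I"
  shows "is_scale_derivative I s (\<lambda>x. c + (LINT z=ereal e..ereal x|M. f z)) f"
  unfolding is_scale_derivative_iff
  using f primitive_diff[OF f e] by auto

section \<open>Uniqueness of the scale derivative\<close>

lemma Int_stable_Ioc: "Int_stable ((\<lambda>(c, d). {c<..d}) ` {(c, d). c \<le> d \<and> c \<in> I \<and> d \<in> I})"
proof (rule Int_stableI)
  fix A B
  assume "A \<in> (\<lambda>(c, d). {c<..d}) ` {(c, d). c \<le> d \<and> c \<in> I \<and> d \<in> I}"
    "B \<in> (\<lambda>(c, d). {c<..d}) ` {(c, d). c \<le> d \<and> c \<in> I \<and> d \<in> I}"
  then obtain c d c' d' where *: "A = {c<..d}" "B = {c'<..d'}" "c \<in> I" "d \<in> I" "c' \<in> I" "d' \<in> I"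
    "c \<le> d" "c' \<le> d'" by auto
  \<comment> \<open>The second \<open>max\<close> writes an empty intersection as a degenerate
    interval with end points in \<open>I\<close>, which belongs to the family.\<close>
  then have "A \<inter> B = {max c c'<..max (max c c') (min d d')}" by auto
  moreover have "max c c' \<in> I" "max (max c c') (min d d') \<in> I" using * by (auto simp: max_def min_def)
  ultimately show "A \<inter> B \<in> (\<lambda>(c, d). {c<..d}) ` {(c, d). c \<le> d \<and> c \<in> I \<and> d \<in> I}" by force
qed

lemma Ioc_Pow: "(\<lambda>(c, d). {c<..d}) ` {(c, d). c \<le> d \<and> c \<in> I \<and> d \<in> I} \<subseteq> Pow I"
  using Ioc_subset by blast

text \<open>Cut off to a fixed interval, \<open>v\<close> is integrable, and the sets over which its
  integral vanishes form a Dynkin system containing the half-open intervals.\<close>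

lemma AE_zero_of_Ioc_integrals:
  assumes v: "locally_integrable v"
    and zero: "\<And>x y. x \<in> I \<Longrightarrow> y \<in> I \<Longrightarrow> x < y \<Longrightarrow> (LINT z:{x<..y}|M. v z) = 0"
  shows "AE x in M. v x = 0"
proof (rule AE_local)
  show "space M \<subseteq> I" by (simp add: space_M)
  fix c d assume cd: "c \<in> I" "d \<in> I" "c < d"
  define w where "w x = indicator {c<..d} x * v x" for x
  have w: "integrable M w"
    using locally_integrableD[OF v cd(1,2)] by (simp add: w_def[abs_def] set_integrable_def)
  have w_set: "set_integrable M A w" if "A \<in> sets M" for A
    using integrable_mult_indicator[OF that w] by (simp add: set_integrable_def)
  let ?G = "(\<lambda>(c, d). {c<..d}) ` {(c, d). c \<le> d \<and> c \<in> I \<and> d \<in> I}"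
  have sets_eq: "sets M = sigma_sets I ?G"
    unfolding I_eq by (rule sets_stieltjes)
  have Ioc: "(LINT x:{p<..q}|M. w x) = 0" if "p \<in> I" "q \<in> I" for p q
  proof -
    have "(LINT x:{p<..q}|M. w x) = (LINT x:{max p c<..min q d}|M. v x)"
      unfolding set_lebesgue_integral_def w_def
      by (intro Bochner_Integration.integral_cong) (auto simp: indicator_def)
    also have "\<dots> = 0"
      using that cd zero[of "max p c" "min q d"]
      by (cases "max p c < min q d") (auto simp: set_lebesgue_integral_def max_def min_def)
    finally show ?thesis .
  qed
  have "(LINT x:A|M. w x) = 0" if "A \<in> sets M" for A
    using that[unfolded sets_eq]
  proof (induction rule: sigma_sets_induct_disjoint[OF Int_stable_Ioc Ioc_Pow, consumes 1, case_names basic empty compl union])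
    case (basic A)
    then show ?case using Ioc by auto
  next
    case empty
    then show ?case by (simp add: set_lebesgue_integral_def)
  next
    case (compl A)
    then have A: "A \<in> sets M" by (simp add: sets_eq)
    have I: "I \<in> sets M" using sets.top[of M] by (simp add: space_M)
    \<comment> \<open>For complements: the integral of \<open>w\<close> over all of \<open>I\<close>
      is the one over \<open>{c<..d}\<close>, which is zero.\<close>
    have "(LINT x:I|M. w x) = (LINT x:{c<..d}|M. w x)"
      unfolding set_lebesgue_integral_def w_def using Ioc_subset[OF cd(1,2)]
      by (intro Bochner_Integration.integral_cong) (auto simp: indicator_def)
    moreover have "(LINT x:I|M. w x) = (LINT x:A|M. w x) + (LINT x:I - A|M. w x)"
      using sets.sets_into_space[OF A] A I w_set
      by (subst set_integral_Un[symmetric]) (auto simp: space_M Un_absorb1)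
    ultimately show ?case using compl Ioc cd by simp
  next
    case (union A)
    then have A: "\<And>i. A i \<in> sets M" by (auto simp: sets_eq)
    have "(LINT x:(\<Union>i. A i)|M. w x) = (\<Sum>i. (LINT x:(A i)|M. w x))"
      using A union by (intro lebesgue_integral_countable_add w_set) (auto simp: disjoint_family_on_def)
    then show ?case using union by simp
  qed
  then have "AE x in M. w x = 0"
    by (intro density_unique_real[OF w]) auto
  then show "AE x in M. x \<in> {c<..d} \<longrightarrow> v x = 0"
    by eventually_elim (auto simp: w_def)
qed

lemma locally_integrable_lincomb:
  assumes "locally_integrable f" "locally_integrable g"
  shows "locally_integrable (\<lambda>x. p * f x + q * g x)"
  using assms unfolding locally_integrable_def by auto

lemma set_integral_lincomb:
  assumes "set_integrable N A f" "set_integrable N A g"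
  shows "(LINT x:A|N. p * f x + q * g x) = p * (LINT x:A|N. f x) + q * (LINT x:A|N. (g x :: real))"
  using assms by (subst set_integral_add) auto

lemma is_scale_derivative_lincomb:
  assumes u: "is_scale_derivative I s u f" and v: "is_scale_derivative I s v g"
  shows "is_scale_derivative I s (\<lambda>x. p * u x + q * v x) (\<lambda>x. p * f x + q * g x)"
  unfolding is_scale_derivative_iff
proof (intro conjI ballI impI)
  have f: "locally_integrable f" and g: "locally_integrable g"
    using u v by (auto simp: is_scale_derivative_iff)
  then show "locally_integrable (\<lambda>x. p * f x + q * g x)" by (rule locally_integrable_lincomb)
  fix x y assume xy: "x \<in> I" "y \<in> I" "x < y"
  have "(LINT z:{x<..y}|M. p * f z + q * g z) = p * (u y - u x) + q * (v y - v x)"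
    using xy f g u v unfolding is_scale_derivative_iff
    by (subst set_integral_lincomb) (auto intro: locally_integrableD)
  then show "p * u y + q * v y - (p * u x + q * v x) = (LINT z:{x<..y}|M. p * f z + q * g z)"
    by (simp add: algebra_simps)
qed

text \<open>The difference is a derivative of the zero function. Hence the arbitrary choice in
  \<open>scale_derivative\<close> may be replaced by any explicit derivative under
  integrals.\<close>

lemma is_scale_derivative_unique:
  assumes f: "is_scale_derivative I s u f" and g: "is_scale_derivative I s u g"
  shows "AE x in M. f x = g x"
proof -
  have *: "is_scale_derivative I s (\<lambda>x. 1 * u x + - 1 * u x) (\<lambda>x. 1 * f x + - 1 * g x)"
    using f g by (rule is_scale_derivative_lincomb)
  have "AE x in M. 1 * f x + - 1 * g x = 0"
    by (rule AE_zero_of_Ioc_integrals) (use * in \<open>auto simp: is_scale_derivative_iff\<close>)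
  then show ?thesis by simp
qed

lemma is_scale_derivative_cong:
  assumes "\<And>x. x \<in> I \<Longrightarrow> u x = v x"
  shows "is_scale_derivative I s u f \<longleftrightarrow> is_scale_derivative I s v f"
  using assms by (simp add: is_scale_derivative_def)

text \<open>A derivative sees only the values on \<open>I\<close>, so both sides choose from the
  same predicate; the equality therefore holds everywhere, not just almost everywhere.\<close>

lemma scale_derivative_cong:
  assumes "\<And>x. x \<in> I \<Longrightarrow> u x = v x"
  shows "scale_derivative I s u = scale_derivative I s v"
  unfolding scale_derivative_def
  by (intro arg_cong[where f = Eps] ext is_scale_derivative_cong assms)

lemma is_scale_derivative_AE_cong:
  assumes f: "is_scale_derivative I s u f" and g[measurable]: "g \<in> borel_measurable M"
    and eq: "AE x in M. f x = g x"
  shows "is_scale_derivative I s u g"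
proof -
  have [measurable]: "f \<in> borel_measurable M" using f by (simp add: is_scale_derivative_def)
  have *: "set_integrable M {x<..y} f \<longleftrightarrow> set_integrable M {x<..y} g"
    "(LINT z:{x<..y}|M. f z) = (LINT z:{x<..y}|M. g z)" if "x \<in> I" "y \<in> I" for x y
  proof -
    note [measurable] = sets_Ioc[OF that]
    have "AE z in M. indicator {x<..y} z *\<^sub>R f z = indicator {x<..y} z *\<^sub>R g z"
      using eq by eventually_elim simp
    then show "set_integrable M {x<..y} f \<longleftrightarrow> set_integrable M {x<..y} g"
      "(LINT z:{x<..y}|M. f z) = (LINT z:{x<..y}|M. g z)"
      unfolding set_integrable_def set_lebesgue_integral_def
      by (intro integrable_cong_AE integral_cong_AE; measurable)+
  qed
  show ?thesis
    using f * unfolding is_scale_derivative_iff locally_integrable_def by simp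
qed

section \<open>Form domains and energies through arbitrary derivatives\<close>

lemma is_scale_derivative_scale_derivative:
  "is_scale_derivative I s u f \<Longrightarrow> is_scale_derivative I s u (scale_derivative I s u)"
  unfolding scale_derivative_def by (rule someI[where P = "is_scale_derivative I s u"])

lemma scale_derivative_AE:
  "is_scale_derivative I s u f \<Longrightarrow> AE x in M. scale_derivative I s u x = f x"
  by (rule is_scale_derivative_unique[OF is_scale_derivative_scale_derivative])

lemma scale_derivative_measurable:
  "is_scale_derivative I s u f \<Longrightarrow> scale_derivative I s u \<in> borel_measurable M"
  using is_scale_derivative_scale_derivative[of u f] by (simp add: is_scale_derivative_def)

text \<open>The definition tests the chosen derivative; by uniqueness a square integrable derivative
  of any origin will do.\<close>

lemma form_domainI:
  assumes "u \<in> L2 m" "is_scale_derivative I s u f" "f \<in> L2 M"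
  shows "u \<in> form_domain I s m"
proof -
  have "scale_derivative I s u \<in> L2 M"
    using scale_derivative_AE[OF assms(2)]
    by (intro L2_cong_AE[OF assms(3) scale_derivative_measurable[OF assms(2)]]) auto
  then show ?thesis
    using assms by (auto simp: form_domain_def scale_abs_continuous_def)
qed

lemma form_domainD:
  assumes "u \<in> form_domain I s m"
  shows "u \<in> L2 m" "is_scale_derivative I s u (scale_derivative I s u)" "scale_derivative I s u \<in> L2 M"
  using assms is_scale_derivative_scale_derivative
  by (auto simp: form_domain_def scale_abs_continuous_def)

lemma energy_eq:
  assumes f: "is_scale_derivative I s u f" and g: "is_scale_derivative I s v g"
  shows "energy I s u v = 1 / 2 * (LINT x|M. f x * g x)"
proof -
  have [measurable]: "f \<in> borel_measurable M" "g \<in> borel_measurable M"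
    using f g by (auto simp: is_scale_derivative_def)
  note [measurable] = scale_derivative_measurable[OF f] scale_derivative_measurable[OF g]
  have "(LINT x|M. scale_derivative I s u x * scale_derivative I s v x) = (LINT x|M. f x * g x)"
    using scale_derivative_AE[OF f] scale_derivative_AE[OF g] by (intro integral_cong_AE) auto
  then show ?thesis by (simp add: energy_def)
qed

lemma restricted_domainI:
  assumes "u \<in> L2 m" "is_scale_derivative I s u f" "f \<in> L2 M" "AE x in M. x \<in> F \<longrightarrow> f x = 0"
  shows "u \<in> restricted_domain I s m F"
  using form_domainI[OF assms(1-3)] assms(4) scale_derivative_AE[OF assms(2)]
  by (auto simp: restricted_domain_def)

text \<open>Lets closedness of the restricted forms cover the unrestricted ones.\<close>

lemma form_domain_eq_restricted: "form_domain I s m = restricted_domain I s m {}"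
  by (auto simp: restricted_domain_def)

end

section \<open>Closedness and lower semicontinuity\<close>

text \<open>Its members are convex combinations, with dyadic coefficients, of the \<open>U n\<close>
  with \<open>N \<le> n\<close>. Closure under midpoints is what the parallelogram identity asks
  for, and properties pass to the hull by induction.\<close>

inductive_set midpoint_hull :: "(nat \<Rightarrow> 'a \<Rightarrow> real) \<Rightarrow> nat \<Rightarrow> ('a \<Rightarrow> real) set"
  for U :: "nat \<Rightarrow> 'a \<Rightarrow> real" and N :: nat where
  base: "N \<le> n \<Longrightarrow> U n \<in> midpoint_hull U N"
| mid: "f \<in> midpoint_hull U N \<Longrightarrow> g \<in> midpoint_hull U N \<Longrightarrow>
    (\<lambda>x. (1/2) * f x + (1/2) * g x) \<in> midpoint_hull U N"

lemma midpoint_hull_antimono: "N \<le> K \<Longrightarrow> midpoint_hull U K \<subseteq> midpoint_hull U N"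
proof
  fix f assume "f \<in> midpoint_hull U K" "N \<le> K"
  then show "f \<in> midpoint_hull U N"
  proof induction
    case (base n)
    then show ?case by (intro midpoint_hull.base) simp
  next
    case (mid f g)
    then show ?case by (intro midpoint_hull.mid)
  qed
qed

text \<open>The scale is a parameter so that the results for \<open>s\<close> can be reused by
  interpretation at \<open>associated_scale I s e G\<close> with the same \<open>m\<close> and
  \<open>e\<close>.\<close>

locale interval_form = interval_scale +
  fixes m :: "real measure" and e :: real
  assumes radon: "fully_supported_radon I m"
    and e: "e \<in> I"
begin

section \<open>The reference measure and continuous representatives\<close>

lemma sets_m: "sets m = sets M"
  using radon by (simp add: sets_M fully_supported_radon_def)

lemma space_m: "space m = I"
  using sets_eq_imp_space_eq[OF sets_m] by (simp add: space_M)

lemma emeasure_m_finite: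
  assumes "c \<in> I" "d \<in> I" "A \<subseteq> {c<..d}"
  shows "emeasure m A < \<infinity>"
proof -
  have "emeasure m A \<le> emeasure m {c..d}"
    using assms Icc_subset[of c d]
    by (intro emeasure_mono) (auto simp: sets_m intro!: sets_borel_subset)
  also have "\<dots> < \<infinity>"
    using radon Icc_subset[of c d] assms by (simp add: fully_supported_radon_def)
  finally show ?thesis .
qed

lemma open_m_pos: "open U \<Longrightarrow> U \<subseteq> I \<Longrightarrow> U \<noteq> {} \<Longrightarrow> 0 < emeasure m U"
  using radon by (simp add: fully_supported_radon_def)

lemma measure_m_Ioc_pos:
  assumes "c \<in> I" "d \<in> I" "c < d"
  shows "0 < measure m {c<..d}"
proof -
  have "0 < emeasure m {c<..<d}"
    using assms Ioc_subset[of c d] by (intro open_m_pos) auto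
  also have "\<dots> \<le> emeasure m {c<..d}"
    using assms by (intro emeasure_mono) (auto simp: sets_m sets_Ioc)
  finally show ?thesis
    using emeasure_m_finite[OF assms(1,2) order_refl]
    by (simp add: measure_def enn2real_positive_iff)
qed

text \<open>Cauchy-Schwarz against the indicator of \<open>{x<..y}\<close>, whose square has
  integral \<open>s y - s x\<close>.\<close>

lemma scale_Hoelder_le:
  assumes u: "is_scale_derivative I s u f" and f: "f \<in> L2 M" and xy: "x \<in> I" "y \<in> I" "x \<le> y"
  shows "(u y - u x)\<^sup>2 \<le> (LINT z|M. (f z)\<^sup>2) * (s y - s x)"
proof (cases "x = y")
  case False
  then have "u y - u x = (LINT z:{x<..y}|M. f z)"
    using u xy by (simp add: is_scale_derivative_iff)
  then show ?thesis
    using L2_set_integral_le[OF f sets_Ioc[OF xy(1,2)]] xy by (simp add: emeasure_Ioc measure_Ioc)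
qed simp

lemma scale_Hoelder:
  assumes u: "is_scale_derivative I s u f" and f: "f \<in> L2 M" and xy: "x \<in> I" "y \<in> I"
  shows "\<bar>u y - u x\<bar> \<le> sqrt ((LINT z|M. (f z)\<^sup>2) * \<bar>s y - s x\<bar>)"
proof (rule real_le_rsqrt)
  show "\<bar>u y - u x\<bar>\<^sup>2 \<le> (LINT z|M. (f z)\<^sup>2) * \<bar>s y - s x\<bar>"
  proof (cases "x \<le> y")
    case True
    then show ?thesis
      using scale_Hoelder_le[OF u f xy] scale_le[OF xy] by simp
  next
    case False
    then show ?thesis
      using scale_Hoelder_le[OF u f xy(2,1)] scale_le[OF xy(2,1)]
      by (simp add: power2_commute[of "u y"])
  qed
qed

lemma continuous_on_scale_derivative:
  assumes u: "is_scale_derivative I s u f" and f: "f \<in> L2 M"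
  shows "continuous_on I u"
  unfolding continuous_on_def
proof
  fix x assume x: "x \<in> I"
  have "(s \<longlongrightarrow> s x) (at x within I)"
    using scaling x by (simp add: scaling_function_def continuous_on_def)
  then have "((\<lambda>y. sqrt ((LINT z|M. (f z)\<^sup>2) * \<bar>s y - s x\<bar>)) \<longlongrightarrow> sqrt ((LINT z|M. (f z)\<^sup>2) * \<bar>s x - s x\<bar>)) (at x within I)"
    by (intro tendsto_intros)
  then have "((\<lambda>y. u y - u x) \<longlongrightarrow> 0) (at x within I)"
    using scale_Hoelder[OF u f x]
    by (intro Lim_null_comparison[of "\<lambda>y. u y - u x" "\<lambda>y. sqrt ((LINT z|M. (f z)\<^sup>2) * \<bar>s y - s x\<bar>)"])
       (auto simp: eventually_at_filter)
  then show "(u \<longlongrightarrow> u x) (at x within I)"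
    by (simp add: LIM_zero_iff)
qed

lemma continuous_on_m_measurable: "continuous_on I u \<Longrightarrow> u \<in> borel_measurable m"
  using borel_measurable_continuous_on_restrict[of I u]
    measurable_cong_sets[OF trans[OF sets_m sets_M] refl] by blast

text \<open>The set of disagreement is open and \<open>m\<close>-null, so full support leaves only
  the empty set. Thus a class in \<open>L2 m\<close> has at most one continuous representative on
  \<open>I\<close>.\<close>

lemma AE_m_eq_imp_eq:
  assumes u: "continuous_on I u" and v: "continuous_on I v" and eq: "AE x in m. u x = v x"
    and x: "x \<in> I"
  shows "u x = (v x :: real)"
proof (rule ccontr)
  assume ne: "u x \<noteq> v x"
  define W where "W = I \<inter> (\<lambda>x. u x - v x) -` (- {0})"
  have "continuous_on I (\<lambda>x. u x - v x)" using u v by (intro continuous_intros)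
  then have W: "open W"
    unfolding W_def by (intro continuous_open_preimage open_I) auto
  have "0 < emeasure m W"
    using W ne x by (intro open_m_pos) (auto simp: W_def)
  moreover have "W \<in> sets m"
    using W by (auto simp: sets_m W_def intro!: sets_borel_subset)
  then have "W \<in> null_sets m"
    using eq AE_iff_null_sets[of W m] by (auto simp: W_def elim!: eventually_mono)
  ultimately show False by auto
qed

section \<open>Local convergence of integrals and identification of the limit\<close>

lemma bounded_set_integrable_m:
  fixes f :: "real \<Rightarrow> real"
  assumes f: "f \<in> borel_measurable m" and cd: "c \<in> I" "d \<in> I"
    and A: "A \<in> sets m" "A \<subseteq> {c<..d}" and B: "\<And>x. x \<in> A \<Longrightarrow> \<bar>f x\<bar> \<le> B"
  shows "set_integrable m A f" "\<bar>LINT x:A|m. f x\<bar> \<le> B * measure m A"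
proof -
  have fin: "emeasure m A < \<infinity>" using emeasure_m_finite[OF cd A(2)] .
  show int: "set_integrable m A f"
    unfolding set_integrable_def
    using f A(1) fin B by (intro integrableI_bounded_set_indicator[where B = B]) auto
  have const: "set_integrable m A (\<lambda>x. B)"
    using A(1) fin by (simp add: set_integrable_def)
  have "\<bar>LINT x:A|m. f x\<bar> \<le> (LINT x:A|m. \<bar>f x\<bar>)"
    using set_integral_norm_bound[OF int] by simp
  also have "\<dots> \<le> (LINT x:A|m. B)"
    using set_integrable_abs[OF int] const B by (intro set_integral_mono) auto
  also have "\<dots> = B * measure m A"
    using A(1) fin sets.sets_into_space[OF A(1)] by (simp add: set_lebesgue_integral_def Int_absorb2)
  finally show "\<bar>LINT x:A|m. f x\<bar> \<le> B * measure m A" .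
qed

text \<open>A common consequence of weak and strong convergence in \<open>L2 m\<close>. Sets inside
  some \<open>{c<..d}\<close> have finite \<open>m\<close>-measure, so their indicators are
  admissible test functions, and closeness of the integrals is stable under midpoints.\<close>

definition locally_tends :: "(nat \<Rightarrow> real \<Rightarrow> real) \<Rightarrow> (real \<Rightarrow> real) \<Rightarrow> bool" where
  "locally_tends U u \<longleftrightarrow> (\<forall>c\<in>I. \<forall>d\<in>I. \<forall>A\<in>sets m. A \<subseteq> {c<..d} \<longrightarrow>
     (\<lambda>n. LINT x:A|m. U n x) \<longlonglongrightarrow> (LINT x:A|m. u x))"

lemma locally_tendsD:
  "locally_tends U u \<Longrightarrow> c \<in> I \<Longrightarrow> d \<in> I \<Longrightarrow> A \<in> sets m \<Longrightarrow> A \<subseteq> {c<..d} \<Longrightarrow>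
    (\<lambda>n. LINT x:A|m. U n x) \<longlonglongrightarrow> (LINT x:A|m. u x)"
  by (auto simp: locally_tends_def)

lemma weakly_converges_locally_tends:
  assumes "weakly_converges_L2 m U u"
  shows "locally_tends U u"
  unfolding locally_tends_def
proof (intro ballI impI)
  fix c d A assume "c \<in> I" "d \<in> I" "A \<in> sets m" "A \<subseteq> {c<..d}"
  then have "(indicator A :: real \<Rightarrow> real) \<in> L2 m"
    by (intro L2_indicator emeasure_m_finite)
  then have "(\<lambda>n. inner_L2 m (U n) (indicator A)) \<longlonglongrightarrow> inner_L2 m u (indicator A)"
    using assms by (simp add: weakly_converges_L2_def)
  then show "(\<lambda>n. LINT x:A|m. U n x) \<longlonglongrightarrow> (LINT x:A|m. u x)"
    by (simp add: inner_L2_def set_lebesgue_integral_def mult.commute)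
qed

lemma strongly_converges_locally_tends:
  fixes U :: "nat \<Rightarrow> real \<Rightarrow> real"
  assumes U: "\<And>n. U n \<in> L2 m" and u: "u \<in> L2 m"
    and lim: "(\<lambda>n. LINT x|m. (U n x - u x)\<^sup>2) \<longlonglongrightarrow> 0"
  shows "locally_tends U u"
  unfolding locally_tends_def
proof (intro ballI impI)
  fix c d A assume A: "c \<in> I" "d \<in> I" "A \<in> sets m" "A \<subseteq> {c<..d}"
  have fin: "emeasure m A < \<infinity>" using A by (intro emeasure_m_finite)
  have "(\<lambda>n. (LINT x|m. (U n x - u x)\<^sup>2) * measure m A) \<longlonglongrightarrow> 0"
    using tendsto_mult[OF lim tendsto_const] by simp
  then have "(\<lambda>n. (LINT x:A|m. U n x - u x)\<^sup>2) \<longlonglongrightarrow> 0"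
    by (rule Lim_null_comparison[rotated])
       (auto intro!: always_eventually L2_set_integral_le L2_diff U u A fin)
  then have "(\<lambda>n. LINT x:A|m. U n x - u x) \<longlonglongrightarrow> 0"
    by simp
  moreover have "(LINT x:A|m. U n x - u x) = (LINT x:A|m. U n x) - (LINT x:A|m. u x)" for n
    using L2_set_integrable[OF U A(3) fin] L2_set_integrable[OF u A(3) fin] by simp
  ultimately show "(\<lambda>n. LINT x:A|m. U n x) \<longlonglongrightarrow> (LINT x:A|m. u x)"
    by (simp add: LIM_zero_iff)
qed

text \<open>The derivatives determine the limit up to an additive constant, and the constant is read off
  from the integrals over one interval of positive measure.\<close>
lemma local_limit_primitive:
  assumes g: "\<And>n. g n \<in> L2 m" and f: "\<And>n. f n \<in> L2 M" and gf: "\<And>n. is_scale_derivative I s (g n) (f n)"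
    and h: "h \<in> L2 M" and lim: "(\<lambda>n. LINT x|M. (f n x - h x)\<^sup>2) \<longlonglongrightarrow> 0"
    and u: "u \<in> L2 m" and gu: "locally_tends g u"
  obtains w where "w \<in> L2 m" "is_scale_derivative I s w h" "AE x in m. u x = w x"
proof -
  define \<phi> where "\<phi> x = (LINT z=ereal e..ereal x|M. h z)" for x
  have dphi: "is_scale_derivative I s \<phi> h"
    using is_scale_derivative_primitive[OF L2_locally_integrable[OF h] e, of 0] by (simp add: \<phi>_def[abs_def])
  have phi_e: "\<phi> e = 0"
    by (simp add: \<phi>_def primitive_eq[OF L2_locally_integrable[OF h]] e set_lebesgue_integral_def)
  have phi_m: "\<phi> \<in> borel_measurable m"
    by (intro continuous_on_m_measurable continuous_on_scale_derivative[OF dphi h])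
  define \<delta> where "\<delta> n = (LINT x|M. (f n x - h x)\<^sup>2)" for n
  \<comment> \<open>\<open>r n\<close> has derivative \<open>f n - h\<close>, so by the Hoelder
    estimate it is nearly constant on bounded intervals for large \<open>n\<close>.\<close>
  define r where "r n x = g n x - \<phi> x" for n x
  have dr: "is_scale_derivative I s (r n) (\<lambda>x. f n x - h x)" for n
    using is_scale_derivative_lincomb[OF gf dphi, of 1 n "-1"] by (simp add: r_def[abs_def])
  have r_m: "r n \<in> borel_measurable m" for n
    by (intro continuous_on_m_measurable continuous_on_scale_derivative[OF dr L2_diff[OF f h]])
  have r_bound: "\<bar>r n x - r n e\<bar> \<le> sqrt (\<delta> n * \<bar>s x - s e\<bar>)" if "x \<in> I" for n x
    using scale_Hoelder[OF dr L2_diff[OF f h] e that] by (simp add: \<delta>_def)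
  have phi_int: "set_integrable m A \<phi>"
    and g_e: "(\<lambda>n. g n e * measure m A) \<longlonglongrightarrow> (LINT x:A|m. u x) - (LINT x:A|m. \<phi> x)"
    if cd: "c \<in> I" "d \<in> I" and A: "A \<in> sets m" "A \<subseteq> {c<..d}" for c d A
  proof -
    \<comment> \<open>By monotonicity of \<open>s\<close>, the distance from \<open>s e\<close> is
      bounded on \<open>{c<..d}\<close> through the end points.\<close>
    define B where "B = \<bar>s c - s e\<bar> + \<bar>s d - s e\<bar>"
    have fin: "emeasure m A < \<infinity>" using emeasure_m_finite[OF cd A(2)] .
    have xI: "x \<in> I" if "x \<in> A" for x using that A Ioc_subset[OF cd] by auto
    have B: "\<bar>s x - s e\<bar> \<le> B" if "x \<in> A" for x
      using scale_le[OF cd(1) xI[OF that]] scale_le[OF xI[OF that] cd(2)] that A(2) by (force simp: B_def)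
    have "\<bar>\<phi> x\<bar> \<le> sqrt ((LINT z|M. (h z)\<^sup>2) * B)" if "x \<in> A" for x
      using scale_Hoelder[OF dphi h e xI[OF that]] phi_e B[OF that]
      by (auto elim!: order_trans intro!: mult_left_mono)
    with phi_m cd A show phi_int: "set_integrable m A \<phi>"
      by (intro bounded_set_integrable_m) auto
    have "\<bar>r n x - r n e\<bar> \<le> sqrt (\<delta> n * B)" if "x \<in> A" for n x
      using B[OF that]
      by (intro order_trans[OF r_bound[OF xI[OF that]]] real_sqrt_le_mono mult_left_mono) (auto simp: \<delta>_def)
    note r_bdd = bounded_set_integrable_m[OF borel_measurable_diff[OF r_m borel_measurable_const] cd A this]
    have r0: "(\<lambda>n. LINT x:A|m. r n x - r n e) \<longlonglongrightarrow> 0"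
    proof (rule Lim_null_comparison[rotated])
      show "(\<lambda>n. sqrt (\<delta> n * B) * measure m A) \<longlonglongrightarrow> 0"
        using tendsto_mult[OF tendsto_real_sqrt[OF tendsto_mult[OF lim tendsto_const[of B]]] tendsto_const[of "measure m A"]]
        by (simp add: \<delta>_def)
      show "eventually (\<lambda>n. norm (LINT x:A|m. r n x - r n e) \<le> sqrt (\<delta> n * B) * measure m A) sequentially"
        unfolding real_norm_def by (intro always_eventually allI r_bdd(2))
    qed
    have const: "set_integrable m A (\<lambda>x. k)" "(LINT x:A|m. k) = k * measure m A" for k :: real
      using A(1) fin sets.sets_into_space[OF A(1)]
      by (auto simp: set_integrable_def set_lebesgue_integral_def Int_absorb2)
    \<comment> \<open>Since \<open>\<phi> e = 0\<close>, \<open>r n e\<close> is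
      \<open>g n e\<close>; thus \<open>g n\<close> splits into \<open>\<phi>\<close>, a remainder
      that is uniformly small on \<open>A\<close>, and the constant \<open>g n e\<close>.\<close>
    have "(LINT x:A|m. g n x) - (LINT x:A|m. \<phi> x) - (LINT x:A|m. r n x - r n e) = g n e * measure m A" for n
    proof -
      have "(LINT x:A|m. g n x) = (LINT x:A|m. (\<phi> x + (r n x - r n e)) + g n e)"
        by (simp add: r_def phi_e)
      also have "\<dots> = (LINT x:A|m. \<phi> x) + (LINT x:A|m. r n x - r n e) + g n e * measure m A"
        by (simp only: set_integral_add phi_int r_bdd(1) const)
      finally show ?thesis by simp
    qed
    moreover have "(\<lambda>n. (LINT x:A|m. g n x) - (LINT x:A|m. \<phi> x) - (LINT x:A|m. r n x - r n e)) \<longlonglongrightarrow>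
        (LINT x:A|m. u x) - (LINT x:A|m. \<phi> x) - 0"
      using locally_tendsD[OF gu cd A] r0 by (intro tendsto_intros)
    ultimately show "(\<lambda>n. g n e * measure m A) \<longlonglongrightarrow> (LINT x:A|m. u x) - (LINT x:A|m. \<phi> x)"
      by simp
  qed
  obtain r' where r': "0 < r'" "ball e r' \<subseteq> I"
    using open_I e by (auto simp: open_contains_ball)
  define p where "p = e + r' / 2"
  have p: "p \<in> I" "e < p" using r' by (auto simp: p_def dist_real_def subset_eq)
  \<comment> \<open>The constant to be added to \<open>\<phi>\<close>, forced by the case
    \<open>A = {e<..p}\<close>; \<open>m\<close> charges this interval, so the division makes
    sense.\<close>
  define \<alpha> where "\<alpha> = ((LINT x:{e<..p}|m. u x) - (LINT x:{e<..p}|m. \<phi> x)) / measure m {e<..p}"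
  have pos: "measure m {e<..p} \<noteq> 0" using measure_m_Ioc_pos[OF e p] by simp
  have "(\<lambda>n. g n e * measure m {e<..p} / measure m {e<..p}) \<longlonglongrightarrow> \<alpha>"
    unfolding \<alpha>_def using pos g_e[OF e p(1) _ order_refl] e p
    by (intro tendsto_divide tendsto_const) (auto simp: sets_m sets_Ioc)
  then have g_lim: "(\<lambda>n. g n e) \<longlonglongrightarrow> \<alpha>" using pos by simp
  define w where "w x = \<alpha> + \<phi> x" for x
  have w_m: "w \<in> borel_measurable m" using phi_m by (simp add: w_def[abs_def])
  have "AE x in m. u x = w x"
  proof (rule AE_local)
    show "space m \<subseteq> I" by (simp add: space_m)
    fix c d assume cd: "c \<in> I" "d \<in> I" "c < d"
    have K: "{c<..d} \<in> sets m" using cd by (simp add: sets_m sets_Ioc)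
    have fin: "emeasure m {c<..d} < \<infinity>" using emeasure_m_finite[OF cd(1,2) order_refl] .
    have ui: "set_integrable m {c<..d} u" by (rule L2_set_integrable[OF u K fin])
    have wi: "set_integrable m {c<..d} w"
      unfolding w_def using K fin
      by (intro set_integral_add(1) phi_int[OF cd(1,2)]) (auto simp: set_integrable_def)
    have "AE x in m. indicator {c<..d} x *\<^sub>R u x = indicator {c<..d} x *\<^sub>R w x"
    proof (rule density_unique_real)
      show "integrable m (\<lambda>x. indicator {c<..d} x *\<^sub>R u x)" "integrable m (\<lambda>x. indicator {c<..d} x *\<^sub>R w x)"
        using ui wi by (simp_all add: set_integrable_def)
      fix A' assume A': "A' \<in> sets m"
      define A where "A = A' \<inter> {c<..d}"
      have A: "A \<in> sets m" "A \<subseteq> {c<..d}" using A' K by (auto simp: A_def)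
      have finA: "emeasure m A < \<infinity>" using emeasure_m_finite[OF cd(1,2) A(2)] .
      have "(\<lambda>n. g n e * measure m A) \<longlonglongrightarrow> \<alpha> * measure m A"
        using g_lim by (intro tendsto_intros)
      \<comment> \<open>Two limits of \<open>g n e * measure m A\<close> are equated: one from
        \<open>g_lim\<close>, one from testing against \<open>A\<close>.\<close>
      then have "(LINT x:A|m. u x) - (LINT x:A|m. \<phi> x) = \<alpha> * measure m A"
        using g_e[OF cd(1,2) A] by (rule LIMSEQ_unique[rotated])
      moreover have "(LINT x:A|m. w x) = \<alpha> * measure m A + (LINT x:A|m. \<phi> x)"
        unfolding w_def using A finA sets.sets_into_space[OF A(1)] phi_int[OF cd(1,2) A]
        by (subst set_integral_add(2)) (auto simp: set_integrable_def set_lebesgue_integral_def Int_absorb2)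
      ultimately have "(LINT x:A|m. u x) = (LINT x:A|m. w x)" by simp
      moreover have "(LINT x:A'|m. indicator {c<..d} x *\<^sub>R v x) = (LINT x:A|m. v x)" for v :: "real \<Rightarrow> real"
        unfolding set_lebesgue_integral_def A_def
        by (intro Bochner_Integration.integral_cong) (auto simp: indicator_def)
      ultimately show "(LINT x:A'|m. indicator {c<..d} x *\<^sub>R u x) = (LINT x:A'|m. indicator {c<..d} x *\<^sub>R w x)"
        by simp
    qed
    then show "AE x in m. x \<in> {c<..d} \<longrightarrow> u x = w x"
      by eventually_elim auto
  qed
  moreover from this have "w \<in> L2 m" by (intro L2_cong_AE[OF u w_m])
  moreover have "is_scale_derivative I s w h"
    using is_scale_derivative_primitive[OF L2_locally_integrable[OF h] e] by (simp add: w_def[abs_def] \<phi>_def)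
  ultimately show ?thesis using that by blast
qed

section \<open>Linear structure and closedness of the restricted forms\<close>

lemma restricted_domainD:
  assumes "u \<in> restricted_domain I s m F"
  shows "u \<in> L2 m" "is_scale_derivative I s u (scale_derivative I s u)" "scale_derivative I s u \<in> L2 M"
    "AE x in M. x \<in> F \<longrightarrow> scale_derivative I s u x = 0"
  using assms form_domainD[of u m] by (auto simp: restricted_domain_def)

lemma restricted_domain_lincomb:
  assumes u: "u \<in> restricted_domain I s m F" and v: "v \<in> restricted_domain I s m F"
  shows "(\<lambda>x. p * u x + q * v x) \<in> restricted_domain I s m F"
proof (rule restricted_domainI)
  note ud = restricted_domainD[OF u] and vd = restricted_domainD[OF v]
  show "(\<lambda>x. p * u x + q * v x) \<in> L2 m" by (intro L2_lincomb ud vd)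
  show "is_scale_derivative I s (\<lambda>x. p * u x + q * v x)
      (\<lambda>x. p * scale_derivative I s u x + q * scale_derivative I s v x)"
    by (intro is_scale_derivative_lincomb ud vd)
  show "(\<lambda>x. p * scale_derivative I s u x + q * scale_derivative I s v x) \<in> L2 M"
    by (intro L2_lincomb ud vd)
  show "AE x in M. x \<in> F \<longrightarrow> p * scale_derivative I s u x + q * scale_derivative I s v x = 0"
    using ud(4) vd(4) by eventually_elim auto
qed

lemma restricted_domain_zero: "(\<lambda>x. 0) \<in> restricted_domain I s m F"
proof (rule restricted_domainI)
  show "is_scale_derivative I s (\<lambda>x. 0) (\<lambda>x. 0)"
    by (simp add: is_scale_derivative_iff locally_integrable_def set_integrable_def set_lebesgue_integral_def)
qed (auto intro: L2_zero)

lemma energy_lincomb_self: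
  assumes u: "u \<in> restricted_domain I s m F" and v: "v \<in> restricted_domain I s m F"
  shows "energy I s (\<lambda>x. p * u x + q * v x) (\<lambda>x. p * u x + q * v x) =
    1 / 2 * (LINT x|M. (p * scale_derivative I s u x + q * scale_derivative I s v x)\<^sup>2)"
  unfolding power2_eq_square
  using restricted_domainD[OF u] restricted_domainD[OF v]
  by (intro energy_eq is_scale_derivative_lincomb) auto

lemma energy_self: "energy I s u u = 1 / 2 * (LINT x|M. (scale_derivative I s u x)\<^sup>2)"
  by (simp add: energy_def power2_eq_square)

lemma energy_diff_self:
  assumes u: "u \<in> restricted_domain I s m F" and v: "v \<in> restricted_domain I s m F"
  shows "energy I s (\<lambda>x. u x - v x) (\<lambda>x. u x - v x) =
    1 / 2 * (LINT x|M. (scale_derivative I s u x - scale_derivative I s v x)\<^sup>2)"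
  using energy_lincomb_self[OF u v, of 1 "-1"] by simp

text \<open>Shared by closedness and lower semicontinuity, which differ in how the derivatives come
  to be Cauchy. The condition on \<open>F\<close> survives because there the squared distance of
  each derivative from the limit \<open>h\<close> is the square of \<open>h\<close>.\<close>

lemma local_limit_in_domain:
  assumes g: "\<And>n. g n \<in> restricted_domain I s m F" and F: "F \<in> sets M"
    and Cauchy: "\<And>\<epsilon>. 0 < \<epsilon> \<Longrightarrow> \<exists>N. \<forall>k\<ge>N. \<forall>l\<ge>N.
      (LINT x|M. (scale_derivative I s (g k) x - scale_derivative I s (g l) x)\<^sup>2) < \<epsilon>"
    and u: "u \<in> L2 m" and gu: "locally_tends g u"
  obtains w where "w \<in> restricted_domain I s m F" "AE x in m. u x = w x"
    "(\<lambda>n. LINT x|M. (scale_derivative I s (g n) x - scale_derivative I s w x)\<^sup>2) \<longlonglongrightarrow> 0"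
proof -
  note gd = restricted_domainD[OF g]
  obtain h where h: "h \<in> L2 M" and lim: "(\<lambda>n. LINT x|M. (scale_derivative I s (g n) x - h x)\<^sup>2) \<longlonglongrightarrow> 0"
    by (rule L2_complete[OF gd(3) Cauchy])
  obtain w where w: "w \<in> L2 m" "is_scale_derivative I s w h" "AE x in m. u x = w x"
    by (rule local_limit_primitive[OF gd(1,3,2) h lim u gu])
  note [measurable] = L2_measurable[OF h] L2_measurable[OF gd(3)]
  have [measurable]: "F \<in> sets M" by (rule F)
  have Fint: "integrable M (\<lambda>x. indicator F x * (h x)\<^sup>2)"
    using integrable_mult_indicator[OF F L2_integrable_square[OF h]] by simp
  have "(LINT x|M. indicator F x * (h x)\<^sup>2) \<le> (LINT x|M. (scale_derivative I s (g n) x - h x)\<^sup>2)" for n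
  proof (rule integral_mono_AE[OF Fint L2_integrable_square[OF L2_diff[OF gd(3) h]]])
    show "AE x in M. indicator F x * (h x)\<^sup>2 \<le> (scale_derivative I s (g n) x - h x)\<^sup>2"
      using gd(4)[of n] by eventually_elim (auto simp: indicator_def)
  qed
  then have "(LINT x|M. indicator F x * (h x)\<^sup>2) \<le> 0"
    using lim by (intro LIMSEQ_le_const[of _ 0]) auto
  moreover have "0 \<le> (LINT x|M. indicator F x * (h x)\<^sup>2)" by simp
  ultimately have "AE x in M. indicator F x * (h x)\<^sup>2 = 0"
    using integral_nonneg_eq_0_iff_AE[OF Fint] by simp
  then have h0: "AE x in M. x \<in> F \<longrightarrow> h x = 0"
    by eventually_elim (auto simp: indicator_def)
  note [measurable] = scale_derivative_measurable[OF w(2)]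
  have "(LINT x|M. (scale_derivative I s (g n) x - scale_derivative I s w x)\<^sup>2) =
      (LINT x|M. (scale_derivative I s (g n) x - h x)\<^sup>2)" for n
    using scale_derivative_AE[OF w(2)] by (intro integral_cong_AE) auto
  with lim have "(\<lambda>n. LINT x|M. (scale_derivative I s (g n) x - scale_derivative I s w x)\<^sup>2) \<longlonglongrightarrow> 0"
    by simp
  then show ?thesis
    using restricted_domainI[OF w(1,2) h h0] w(3) by (intro that)
qed

lemma closed_form_restricted:
  assumes F: "F \<in> sets M"
  shows "closed_form_wide m (restricted_domain I s m F) (energy I s)"
  unfolding closed_form_wide_def
proof (intro conjI ballI allI impI)
  let ?D = "restricted_domain I s m F"
  show "?D \<subseteq> L2 m" using restricted_domainD by blast
  show "(\<lambda>x. 0) \<in> ?D" by (rule restricted_domain_zero)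
  show "(\<lambda>x. \<alpha> * u x + \<beta> * v x) \<in> ?D" if "u \<in> ?D" "v \<in> ?D" for u v \<alpha> \<beta>
    using that by (rule restricted_domain_lincomb)
  show "energy I s (\<lambda>x. \<alpha> * u x + \<beta> * v x) w = \<alpha> * energy I s u w + \<beta> * energy I s v w"
    if "u \<in> ?D" "v \<in> ?D" "w \<in> ?D" for u v w \<alpha> \<beta>
  proof -
    note ud = restricted_domainD[OF that(1)] and vd = restricted_domainD[OF that(2)] and wd = restricted_domainD[OF that(3)]
    have "energy I s (\<lambda>x. \<alpha> * u x + \<beta> * v x) w = 1 / 2 *
        (LINT x|M. (\<alpha> * scale_derivative I s u x + \<beta> * scale_derivative I s v x) * scale_derivative I s w x)"
      by (intro energy_eq is_scale_derivative_lincomb ud vd wd)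
    also have "\<dots> = 1 / 2 * (LINT x|M. \<alpha> * (scale_derivative I s u x * scale_derivative I s w x)
        + \<beta> * (scale_derivative I s v x * scale_derivative I s w x))"
      by (simp add: algebra_simps)
    also have "\<dots> = \<alpha> * energy I s u w + \<beta> * energy I s v w"
      unfolding energy_def
      using L2_integrable_mult[OF ud(3) wd(3)] L2_integrable_mult[OF vd(3) wd(3)]
      by (subst Bochner_Integration.integral_add) (auto simp: algebra_simps)
    finally show ?thesis .
  qed
  show "energy I s u v = energy I s v u" for u v
    by (simp add: energy_def mult.commute)
  show "0 \<le> energy I s u u" for u by (simp add: energy_self)
  show "energy I s u w = energy I s v w"
    if "u \<in> ?D" "v \<in> ?D" "AE x in m. u x = v x" for u v w
  proof -
    note ud = restricted_domainD[OF that(1)] and vd = restricted_domainD[OF that(2)]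
    \<comment> \<open>Both functions are continuous, so they agree on all of \<open>I\<close>, and
      even the chosen derivatives coincide.\<close>
    have "u x = v x" if "x \<in> I" for x
      using continuous_on_scale_derivative[OF ud(2,3)] continuous_on_scale_derivative[OF vd(2,3)]
        \<open>AE x in m. u x = v x\<close> that by (rule AE_m_eq_imp_eq)
    then have "scale_derivative I s u = scale_derivative I s v" by (rule scale_derivative_cong)
    then show ?thesis by (simp add: energy_def)
  qed
  fix U :: "nat \<Rightarrow> real \<Rightarrow> real"
  assume "(\<forall>n. U n \<in> ?D) \<and> (\<forall>\<epsilon>>0. \<exists>N. \<forall>k\<ge>N. \<forall>l\<ge>N.
           energy I s (\<lambda>x. U k x - U l x) (\<lambda>x. U k x - U l x) + (LINT x|m. (U k x - U l x)\<^sup>2) < \<epsilon>)"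
  then have U: "\<And>n. U n \<in> ?D" and C': "\<And>\<epsilon>. 0 < \<epsilon> \<Longrightarrow> \<exists>N. \<forall>k\<ge>N. \<forall>l\<ge>N.
           energy I s (\<lambda>x. U k x - U l x) (\<lambda>x. U k x - U l x) + (LINT x|m. (U k x - U l x)\<^sup>2) < \<epsilon>"
    by blast+
  have C: "\<And>\<epsilon>. 0 < \<epsilon> \<Longrightarrow> \<exists>N. \<forall>k\<ge>N. \<forall>l\<ge>N.
           1 / 2 * (LINT x|M. (scale_derivative I s (U k) x - scale_derivative I s (U l) x)\<^sup>2)
             + (LINT x|m. (U k x - U l x)\<^sup>2) < \<epsilon>"
    using C' unfolding energy_diff_self[OF U U] .
  note Ud = restricted_domainD[OF U]
  \<comment> \<open>Nonnegativity separates the two summands: the sequence is Cauchy in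
    \<open>L2 m\<close> and its derivatives are Cauchy in \<open>L2 M\<close>.\<close>
  have nn: "0 \<le> (LINT x|N. (f x :: real)\<^sup>2)" for N :: "real measure" and f by simp
  have Cm: "\<exists>N. \<forall>k\<ge>N. \<forall>l\<ge>N. (LINT x|m. (U k x - U l x)\<^sup>2) < \<epsilon>" if \<epsilon>: "0 < \<epsilon>" for \<epsilon>
  proof -
    obtain N where N: "\<forall>k\<ge>N. \<forall>l\<ge>N. 1 / 2 * (LINT x|M. (scale_derivative I s (U k) x - scale_derivative I s (U l) x)\<^sup>2)
             + (LINT x|m. (U k x - U l x)\<^sup>2) < \<epsilon>" using C[OF \<epsilon>] by blast
    show ?thesis
    proof (intro exI allI impI)
      fix k l assume "N \<le> k" "N \<le> l"
      with N have "1 / 2 * (LINT x|M. (scale_derivative I s (U k) x - scale_derivative I s (U l) x)\<^sup>2)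
             + (LINT x|m. (U k x - U l x)\<^sup>2) < \<epsilon>" by blast
      then show "(LINT x|m. (U k x - U l x)\<^sup>2) < \<epsilon>"
        using nn[of M "\<lambda>x. scale_derivative I s (U k) x - scale_derivative I s (U l) x"] by linarith
    qed
  qed
  have CM: "\<exists>N. \<forall>k\<ge>N. \<forall>l\<ge>N. (LINT x|M. (scale_derivative I s (U k) x - scale_derivative I s (U l) x)\<^sup>2) < \<epsilon>"
    if \<epsilon>: "0 < \<epsilon>" for \<epsilon>
  proof -
    \<comment> \<open>\<open>\<epsilon> / 2\<close> compensates the factor 1/2 in the
      energy.\<close>
    obtain N where N: "\<forall>k\<ge>N. \<forall>l\<ge>N. 1 / 2 * (LINT x|M. (scale_derivative I s (U k) x - scale_derivative I s (U l) x)\<^sup>2)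
             + (LINT x|m. (U k x - U l x)\<^sup>2) < \<epsilon> / 2" using C[of "\<epsilon> / 2"] \<epsilon> by auto
    show ?thesis
    proof (intro exI allI impI)
      fix k l assume "N \<le> k" "N \<le> l"
      with N have "1 / 2 * (LINT x|M. (scale_derivative I s (U k) x - scale_derivative I s (U l) x)\<^sup>2)
             + (LINT x|m. (U k x - U l x)\<^sup>2) < \<epsilon> / 2" by blast
      then show "(LINT x|M. (scale_derivative I s (U k) x - scale_derivative I s (U l) x)\<^sup>2) < \<epsilon>"
        using nn[of m "\<lambda>x. U k x - U l x"] by linarith
    qed
  qed
  obtain u where u: "u \<in> L2 m" and lim: "(\<lambda>n. LINT x|m. (U n x - u x)\<^sup>2) \<longlonglongrightarrow> 0"
    by (rule L2_complete[OF Ud(1) Cm])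
  obtain w where w: "w \<in> ?D" "AE x in m. u x = w x"
    and wlim: "(\<lambda>n. LINT x|M. (scale_derivative I s (U n) x - scale_derivative I s w x)\<^sup>2) \<longlonglongrightarrow> 0"
    by (rule local_limit_in_domain[OF U F CM u strongly_converges_locally_tends[OF Ud(1) u lim]])
  note [measurable] = L2_measurable[OF Ud(1)] L2_measurable[OF u] L2_measurable[OF restricted_domainD(1)[OF w(1)]]
  \<comment> \<open>The limit \<open>u\<close> in \<open>L2 m\<close> is exchanged for
    \<open>w\<close>, a representative of its class that lies in the domain.\<close>
  have "(LINT x|m. (U n x - u x)\<^sup>2) = (LINT x|m. (U n x - w x)\<^sup>2)" for n
    using w(2) by (intro integral_cong_AE) auto
  with lim have "(\<lambda>n. LINT x|m. (U n x - w x)\<^sup>2) \<longlonglongrightarrow> 0" by simp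
  from tendsto_add[OF tendsto_mult[OF tendsto_const[of "1/2"] wlim] this]
  show "\<exists>u\<in>?D. (\<lambda>n. energy I s (\<lambda>x. U n x - u x) (\<lambda>x. U n x - u x) + (LINT x|m. (U n x - u x)\<^sup>2)) \<longlonglongrightarrow> 0"
    by (intro bexI[OF _ w(1)]) (simp add: energy_diff_self[OF U w(1)])
qed

lemma energy_parallelogram:
  assumes u: "u \<in> restricted_domain I s m F" and v: "v \<in> restricted_domain I s m F"
  shows "2 * energy I s u u + 2 * energy I s v v
      - 4 * energy I s (\<lambda>x. (1/2) * u x + (1/2) * v x) (\<lambda>x. (1/2) * u x + (1/2) * v x) =
    1 / 2 * (LINT x|M. (scale_derivative I s u x - scale_derivative I s v x)\<^sup>2)"
proof -
  \<comment> \<open>The midpoint is the case \<open>p = q = 1/2\<close> and the difference the case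
    \<open>p = 1\<close>, \<open>q = -1\<close>.\<close>
  note lc = integral_square_lincomb[OF restricted_domainD(3)[OF u] restricted_domainD(3)[OF v]]
  show ?thesis
    unfolding energy_lincomb_self[OF u v] energy_self
    using lc[of "1/2" "1/2"] lc[of 1 "-1"] by (simp add: power2_eq_square[of "_ / _"] field_simps)
qed

text \<open>For fixed \<open>A\<close> and \<epsilon>, the functions whose integral over
  \<open>A\<close> is within \<epsilon> of that of \<open>u\<close> are closed under midpoints;
  integrability is carried through the induction so that integrals add.\<close>

lemma midpoint_hull_locally_tends:
  assumes g: "\<And>n. g n \<in> L2 m" and gu: "locally_tends g u" and f: "\<And>n. f n \<in> midpoint_hull g n"
  shows "locally_tends f u"
  unfolding locally_tends_def
proof (intro ballI impI LIMSEQ_I)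
  fix c d A and \<epsilon> :: real
  assume A: "c \<in> I" "d \<in> I" "A \<in> sets m" "A \<subseteq> {c<..d}" and "0 < \<epsilon>"
  then obtain N where N: "\<And>n. N \<le> n \<Longrightarrow> \<bar>(LINT x:A|m. g n x) - (LINT x:A|m. u x)\<bar> < \<epsilon>"
    using LIMSEQ_D[OF locally_tendsD[OF gu A]] by force
  have fin: "emeasure m A < \<infinity>" using A by (intro emeasure_m_finite)
  have *: "set_integrable m A q \<and> \<bar>(LINT x:A|m. q x) - (LINT x:A|m. u x)\<bar> < \<epsilon>"
    if "q \<in> midpoint_hull g N" for q
    using that
  proof induction
    case (base n)
    then show ?case using N L2_set_integrable[OF g A(3) fin] by simp
  next
    case (mid p q)
    then show ?case
      using set_integral_lincomb[of m A p q "1/2" "1/2"] by auto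
  qed
  show "\<exists>no. \<forall>n\<ge>no. norm ((LINT x:A|m. f n x) - (LINT x:A|m. u x)) < \<epsilon>"
  proof (intro exI allI impI)
    fix n assume "N \<le> n"
    then have "f n \<in> midpoint_hull g N" using f midpoint_hull_antimono by blast
    then show "norm ((LINT x:A|m. f n x) - (LINT x:A|m. u x)) < \<epsilon>" using * by simp
  qed
qed

lemma energy_weakly_lsc:
  assumes g: "\<And>n. g n \<in> restricted_domain I s m F" and F: "F \<in> sets M"
    and C: "\<And>n. energy I s (g n) (g n) \<le> C"
    and u: "u \<in> L2 m" and gu: "locally_tends g u"
  obtains w where "w \<in> restricted_domain I s m F" "AE x in m. u x = w x" "energy I s w w \<le> C"
proof -
  let ?D = "restricted_domain I s m F" and ?Q = "\<lambda>u. energy I s u u"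
    and ?mid = "\<lambda>u v (x::real). (1/2) * u x + (1/2) * v x"
  have hull_D: "f \<in> ?D" if "f \<in> midpoint_hull g n" for f n
    using that by induction (blast intro: g restricted_domain_lincomb)+
  obtain f where f: "\<And>n. f n \<in> midpoint_hull g n" and fC: "\<And>n. ?Q (f n) \<le> C + 1 / real (Suc n)"
    and Cauchy: "\<And>\<epsilon>. 0 < \<epsilon> \<Longrightarrow> \<exists>N. \<forall>k\<ge>N. \<forall>l\<ge>N. 2 * ?Q (f k) + 2 * ?Q (f l) - 4 * ?Q (?mid (f k) (f l)) < \<epsilon>"
  proof (rule near_minimizers_Cauchy[of "midpoint_hull g" ?mid ?Q C])
    show "\<exists>f\<in>midpoint_hull g n. ?Q f \<le> C" for n
      using C by (intro bexI[of _ "g n"] midpoint_hull.base) auto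
    show "?mid u v \<in> midpoint_hull g n" if "u \<in> midpoint_hull g n" "v \<in> midpoint_hull g n" for n u v
      using that by (rule midpoint_hull.mid)
  qed (auto intro: midpoint_hull_antimono[THEN subsetD] simp: energy_self)
  have fD: "f n \<in> ?D" for n using hull_D f by blast
  have CM: "\<exists>N. \<forall>k\<ge>N. \<forall>l\<ge>N. (LINT x|M. (scale_derivative I s (f k) x - scale_derivative I s (f l) x)\<^sup>2) < \<epsilon>"
    if "0 < \<epsilon>" for \<epsilon>
    \<comment> \<open>\<open>\<epsilon> / 2\<close> because the parallelogram identity retains the
      factor 1/2 of the energy.\<close>
    using Cauchy[of "\<epsilon> / 2"] that by (simp only: energy_parallelogram[OF fD fD]) auto
  have fu: "locally_tends f u"
    by (rule midpoint_hull_locally_tends[OF restricted_domainD(1)[OF g] gu f])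
  obtain w where w: "w \<in> ?D" "AE x in m. u x = w x"
    and lim: "(\<lambda>n. LINT x|M. (scale_derivative I s (f n) x - scale_derivative I s w x)\<^sup>2) \<longlonglongrightarrow> 0"
    by (rule local_limit_in_domain[OF fD F CM u fu])
  \<comment> \<open>The squared norm is twice the energy, hence the factor 2; the tolerance
    \<open>1 / real (Suc n)\<close> disappears in the limit.\<close>
  have "(\<lambda>n. 2 * (C + 1 / real (Suc n))) \<longlonglongrightarrow> 2 * (C + 0)"
    by (intro tendsto_intros LIMSEQ_Suc lim_1_over_n)
  moreover have "(LINT x|M. (scale_derivative I s (f n) x)\<^sup>2) \<le> 2 * (C + 1 / real (Suc n))" for n
    using fC[of n] by (simp add: energy_self)
  ultimately have "(LINT x|M. (scale_derivative I s w x)\<^sup>2) \<le> 2 * (C + 0)"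
    by (intro L2_norm_limit_le[OF restricted_domainD(3)[OF fD] restricted_domainD(3)[OF w(1)] lim])
  then show ?thesis
    using w by (intro that) (auto simp: energy_self)
qed

end

section \<open>Associated scales and Mosco convergence\<close>

context interval_form
begin

section \<open>The measure and the form of an associated scale\<close>

lemma locally_integrable_indicator: "G \<in> sets M \<Longrightarrow> locally_integrable (indicator G)"
  unfolding locally_integrable_def set_integrable_def
  by (intro conjI ballI impI integrableI_bounded_set_indicator[where B = 1] sets_Ioc)
     (auto simp: emeasure_Ioc)

lemma associated_scale_diff:
  assumes G: "G \<in> sets M" and xy: "x \<in> I" "y \<in> I" "x \<le> y"
  shows "associated_scale I s e G y - associated_scale I s e G x = measure M (G \<inter> {x<..y})"
proof -
  have "associated_scale I s e G y - associated_scale I s e G x = (LINT z:{x<..y}|M. indicator G z)"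
    unfolding associated_scale_def
    by (rule primitive_diff[OF locally_integrable_indicator[OF G] e xy])
  also have "\<dots> = (LINT z|M. indicator (G \<inter> {x<..y}) z)"
    unfolding set_lebesgue_integral_def
    by (intro Bochner_Integration.integral_cong) (auto simp: indicator_def)
  also have "\<dots> = measure M (G \<inter> {x<..y})"
    using sets.sets_into_space[OF G] by (simp add: Int_absorb2 le_infI1)
  finally show ?thesis .
qed

lemma emeasure_Int_Ioc_finite:
  assumes "x \<in> I" "y \<in> I"
  shows "emeasure M (G \<inter> {x<..y}) < \<infinity>"
proof (cases "x \<le> y")
  case True
  have "emeasure M (G \<inter> {x<..y}) \<le> emeasure M {x<..y}"
    using assms by (intro emeasure_mono sets_Ioc) auto
  also have "\<dots> < \<infinity>" using emeasure_Ioc[OF assms True] by simp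
  finally show ?thesis .
qed simp

text \<open>Fatness of \<open>G\<close> gives strict monotonicity; the increments are dominated by
  those of \<open>s\<close>, so continuity is inherited.\<close>

lemma scaling_associated_scale:
  assumes G: "G \<in> fat_sets I s"
  shows "scaling_function I (associated_scale I s e G)"
  unfolding scaling_function_def
proof
  let ?t = "associated_scale I s e G"
  have GM: "G \<in> sets M" using G by (simp add: fat_sets_def)
  show "strict_mono_on I ?t"
  proof (rule strict_mono_onI)
    fix x y assume xy: "x \<in> I" "y \<in> I" "x < y"
    have "0 < emeasure M (G \<inter> {x<..<y})"
      using G xy by (simp add: fat_sets_def)
    also have "\<dots> \<le> emeasure M (G \<inter> {x<..y})"
      using GM xy by (intro emeasure_mono) (auto intro: sets_Ioc)
    finally have "0 < measure M (G \<inter> {x<..y})"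
      using emeasure_Int_Ioc_finite[OF xy(1,2), of G] by (simp add: measure_def enn2real_positive_iff)
    then show "?t x < ?t y" using associated_scale_diff[OF GM xy(1,2)] xy(3) by simp
  qed
  have le: "\<bar>?t y - ?t x\<bar> \<le> \<bar>s y - s x\<bar>" if "x \<in> I" "y \<in> I" "x \<le> y" for x y
  proof -
    have "measure M (G \<inter> {x<..y}) \<le> measure M {x<..y}"
      using GM that by (intro measure_mono_fmeasurable) (auto simp: fmeasurable_def emeasure_Ioc intro: sets_Ioc)
    then show ?thesis
      using associated_scale_diff[OF GM that] measure_Ioc[OF that] by simp
  qed
  show "continuous_on I ?t"
    unfolding continuous_on_def
  proof
    fix x assume x: "x \<in> I"
    have "(s \<longlongrightarrow> s x) (at x within I)"
      using scaling x by (simp add: scaling_function_def continuous_on_def)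
    then have "((\<lambda>y. \<bar>s y - s x\<bar>) \<longlongrightarrow> \<bar>s x - s x\<bar>) (at x within I)"
      by (intro tendsto_intros)
    moreover have "\<bar>?t y - ?t x\<bar> \<le> \<bar>s y - s x\<bar>" if "y \<in> I" for y
      using le[OF x that] le[OF that x] by (cases "x \<le> y") (auto simp: abs_minus_commute)
    ultimately have "((\<lambda>y. ?t y - ?t x) \<longlongrightarrow> 0) (at x within I)"
      by (intro Lim_null_comparison[of "\<lambda>y. ?t y - ?t x" "\<lambda>y. \<bar>s y - s x\<bar>"])
         (auto simp: eventually_at_filter)
    then show "(?t \<longlongrightarrow> ?t x) (at x within I)"
      by (simp add: LIM_zero_iff)
  qed
qed

lemma interval_form_associated_scale:
  assumes "G \<in> fat_sets I s"
  shows "interval_form a b I (associated_scale I s e G) m e"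
  using scaling_associated_scale[OF assms] I_eq radon e
  by (simp add: interval_form_def interval_form_axioms_def interval_scale_def)

text \<open>Both measures give \<open>{c<..d}\<close> the mass of \<open>G \<inter> {c<..d}\<close>.
  These intervals generate and are stable under intersection, and countably many of finite mass
  exhaust \<open>I\<close>.\<close>

lemma stieltjes_associated_scale:
  assumes G: "G \<in> fat_sets I s"
  shows "stieltjes I (associated_scale I s e G) = density M (\<lambda>x. ennreal (indicator G x))"
proof -
  let ?t = "associated_scale I s e G"
  interpret T: interval_form a b I ?t m e by (rule interval_form_associated_scale[OF G])
  have GM: "G \<in> sets M" using G by (simp add: fat_sets_def)
  have sets_eq: "sets M = sigma_sets I ((\<lambda>(c, d). {c<..d}) ` {(c, d). c \<le> d \<and> c \<in> I \<and> d \<in> I})"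
    unfolding I_eq by (rule sets_stieltjes)
  show ?thesis
  proof (rule measure_eqI_generator_eq_countable[OF Int_stable_Ioc Ioc_Pow])
    show "sets T.M = sigma_sets I ((\<lambda>(c, d). {c<..d}) ` {(c, d). c \<le> d \<and> c \<in> I \<and> d \<in> I})"
      using sets_eq by (simp add: T.sets_M sets_M)
    show "sets (density M (\<lambda>x. ennreal (indicator G x))) = sigma_sets I ((\<lambda>(c, d). {c<..d}) ` {(c, d). c \<le> d \<and> c \<in> I \<and> d \<in> I})"
      using sets_eq by simp
    fix X assume "X \<in> (\<lambda>(c, d). {c<..d}) ` {(c, d). c \<le> d \<and> c \<in> I \<and> d \<in> I}"
    then obtain c d where X: "X = {c<..d}" and cd: "c \<in> I" "d \<in> I" "c \<le> d" by auto
    have "emeasure T.M X = ennreal (measure M (G \<inter> {c<..d}))"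
      unfolding X T.emeasure_Ioc[OF cd] associated_scale_diff[OF GM cd] ..
    also have "\<dots> = emeasure M (G \<inter> {c<..d})"
      using emeasure_Int_Ioc_finite[OF cd(1,2), of G] by (simp add: emeasure_eq_ennreal_measure)
    also have "\<dots> = emeasure (density M (\<lambda>x. ennreal (indicator G x))) X"
      unfolding X ennreal_indicator using GM cd by (subst emeasure_restricted) (auto intro: sets_Ioc)
    finally show "emeasure T.M X = emeasure (density M (\<lambda>x. ennreal (indicator G x))) X" .
  next
    show "(\<lambda>(c, d). {c<..d}) ` Ioc_cover I \<subseteq> (\<lambda>(c, d). {c<..d}) ` {(c, d). c \<le> d \<and> c \<in> I \<and> d \<in> I}"
      using Ioc_coverD[of _ _ I] by (intro image_mono) (auto simp: less_imp_le)
    show "\<Union> ((\<lambda>(c, d). {c<..d}) ` Ioc_cover I) = I" by (rule Union_Ioc_cover[OF open_I])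
    show "countable ((\<lambda>(c, d). {c<..d}) ` Ioc_cover I)" by (intro countable_image countable_Ioc_cover)
    fix X assume "X \<in> (\<lambda>(c, d). {c<..d}) ` Ioc_cover I"
    then obtain c d where "X = {c<..d}" "(c, d) \<in> Ioc_cover I" by auto
    then show "emeasure T.M X \<noteq> \<infinity>" using Ioc_coverD[of c d I] by (simp add: T.emeasure_Ioc)
  qed
qed

text \<open>The density of the new Stieltjes measure passes from the measure to the
  integrand.\<close>

lemma is_scale_derivative_associated_iff:
  assumes G: "G \<in> fat_sets I s" and v: "v \<in> borel_measurable M"
  shows "is_scale_derivative I (associated_scale I s e G) u v \<longleftrightarrow>
    is_scale_derivative I s u (\<lambda>x. indicator G x * v x)"
proof -
  let ?t = "associated_scale I s e G"
  interpret T: interval_form a b I ?t m e by (rule interval_form_associated_scale[OF G])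
  have [measurable]: "G \<in> sets M" using G by (simp add: fat_sets_def)
  note [measurable] = v
  have "set_integrable T.M {x<..y} v \<longleftrightarrow> set_integrable M {x<..y} (\<lambda>z. indicator G z * v z)"
    "(LINT z:{x<..y}|T.M. v z) = (LINT z:{x<..y}|M. indicator G z * v z)" if "x \<in> I" "y \<in> I" for x y
  proof -
    note [measurable] = sets_Ioc[OF that]
    show "set_integrable T.M {x<..y} v \<longleftrightarrow> set_integrable M {x<..y} (\<lambda>z. indicator G z * v z)"
      unfolding set_integrable_def stieltjes_associated_scale[OF G]
      by (subst integrable_density) (auto simp: mult_ac)
    show "(LINT z:{x<..y}|T.M. v z) = (LINT z:{x<..y}|M. indicator G z * v z)"
      unfolding set_lebesgue_integral_def stieltjes_associated_scale[OF G]
      by (subst integral_density) (auto simp: mult_ac)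
  qed
  moreover have "v \<in> borel_measurable T.M"
    using v by (simp add: stieltjes_associated_scale[OF G])
  moreover have "(\<lambda>x. indicator G x * v x) \<in> borel_measurable M" by measurable
  ultimately show ?thesis
    using v unfolding is_scale_derivative_iff T.is_scale_derivative_iff locally_integrable_def T.locally_integrable_def
    by simp
qed

text \<open>A derivative for the new scale, multiplied by the indicator of \<open>G\<close>, is a
  derivative for \<open>s\<close> that vanishes off \<open>G\<close>; conversely a derivative for
  \<open>s\<close> vanishing there is unchanged by this factor. Energies agree because an indicator
  equals its square.\<close>

lemma form_domain_associated:
  assumes G: "G \<in> fat_sets I s"
  shows "form_domain I (associated_scale I s e G) m = restricted_domain I s m (I - G)" (is ?dom)
    and "u \<in> form_domain I (associated_scale I s e G) m \<Longrightarrow> v \<in> form_domain I (associated_scale I s e G) m \<Longrightarrow>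
      energy I (associated_scale I s e G) u v = energy I s u v"
proof -
  let ?t = "associated_scale I s e G"
  interpret T: interval_form a b I ?t m e by (rule interval_form_associated_scale[OF G])
  have [measurable]: "G \<in> sets M" using G by (simp add: fat_sets_def)
  have meas_eq: "borel_measurable T.M = borel_measurable M"
    by (intro measurable_cong_sets refl) (simp add: stieltjes_associated_scale[OF G])
  have L2_iff: "f \<in> L2 T.M \<longleftrightarrow> f \<in> borel_measurable M \<and> integrable M (\<lambda>x. indicator G x * (f x)\<^sup>2)" for f
    unfolding L2_def meas_eq by (auto simp: stieltjes_associated_scale[OF G] integrable_density)
  have deriv: "is_scale_derivative I s u (\<lambda>x. indicator G x * scale_derivative I ?t u x)"
    "scale_derivative I ?t u \<in> borel_measurable M" if "u \<in> form_domain I ?t m" for u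
  proof -
    show *: "scale_derivative I ?t u \<in> borel_measurable M"
      using T.form_domainD[OF that] by (simp add: L2_iff)
    show "is_scale_derivative I s u (\<lambda>x. indicator G x * scale_derivative I ?t u x)"
      using T.form_domainD(2)[OF that] is_scale_derivative_associated_iff[OF G *] by simp
  qed
  show ?dom
  proof (intro equalityI subsetI)
    fix u assume u: "u \<in> form_domain I ?t m"
    note [measurable] = deriv(2)[OF u]
    have "integrable M (\<lambda>x. indicator G x * (scale_derivative I ?t u x)\<^sup>2)"
      using T.form_domainD(3)[OF u] by (simp add: L2_iff)
    moreover have "(\<lambda>x. indicator G x * (scale_derivative I ?t u x)\<^sup>2) =
        (\<lambda>x. (indicator G x * scale_derivative I ?t u x)\<^sup>2)"
      by (auto simp: fun_eq_iff indicator_def)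
    ultimately have "(\<lambda>x. indicator G x * scale_derivative I ?t u x) \<in> L2 M"
      by (simp add: L2_def)
    then show "u \<in> restricted_domain I s m (I - G)"
      using T.form_domainD(1)[OF u] deriv(1)[OF u] by (intro restricted_domainI) auto
  next
    fix u assume u: "u \<in> restricted_domain I s m (I - G)"
    note ud = restricted_domainD[OF u]
    note [measurable] = L2_measurable[OF ud(3)]
    have "is_scale_derivative I s u (\<lambda>x. indicator G x * scale_derivative I s u x)"
    proof (rule is_scale_derivative_AE_cong[OF ud(2)])
      show "AE x in M. scale_derivative I s u x = indicator G x * scale_derivative I s u x"
        using ud(4) AE_space by eventually_elim (auto simp: space_M indicator_def)
    qed measurable
    then have "is_scale_derivative I ?t u (scale_derivative I s u)"
      using is_scale_derivative_associated_iff[OF G L2_measurable[OF ud(3)]] by simp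
    moreover have "scale_derivative I s u \<in> L2 T.M"
      using integrable_mult_indicator[OF \<open>G \<in> sets M\<close> L2_integrable_square[OF ud(3)]] by (simp add: L2_iff)
    ultimately show "u \<in> form_domain I ?t m"
      using ud(1) by (intro T.form_domainI)
  qed
  assume u: "u \<in> form_domain I ?t m" and v: "v \<in> form_domain I ?t m"
  note [measurable] = deriv(2)[OF u] deriv(2)[OF v]
  have "energy I ?t u v = 1 / 2 * (LINT x|M. indicator G x * (scale_derivative I ?t u x * scale_derivative I ?t v x))"
    unfolding energy_def stieltjes_associated_scale[OF G] by (simp add: integral_density)
  also have "\<dots> = 1 / 2 * (LINT x|M. (indicator G x * scale_derivative I ?t u x) * (indicator G x * scale_derivative I ?t v x))"
    by (rule arg_cong[where f = "\<lambda>z. 1 / 2 * z"], rule Bochner_Integration.integral_cong)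
       (auto simp: indicator_def)
  also have "\<dots> = energy I s u v"
    using deriv(1)[OF u] deriv(1)[OF v] by (rule energy_eq[symmetric])
  finally show "energy I ?t u v = energy I s u v" .
qed

lemma extended_energy_associated:
  assumes G: "G \<in> fat_sets I s"
  shows "extended_energy m (form_domain I (associated_scale I s e G) m) (energy I (associated_scale I s e G)) u =
    extended_energy m (restricted_domain I s m (I - G)) (energy I s) u"
  unfolding extended_energy_def
  by (intro INF_cong) (auto simp: form_domain_associated[OF G])

text \<open>Both representatives are continuous, hence agree on \<open>I\<close> and have the same
  chosen derivative. This lets one representative serve several domains at once.\<close>

lemma restricted_domain_eq_representative:
  assumes v: "v \<in> restricted_domain I s m F" and w: "w \<in> restricted_domain I s m F'"
    and eq: "AE x in m. v x = w x"
  shows "w \<in> restricted_domain I s m F"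
proof -
  note vd = restricted_domainD[OF v] and wd = restricted_domainD[OF w]
  have "v x = w x" if "x \<in> I" for x
    using continuous_on_scale_derivative[OF vd(2,3)] continuous_on_scale_derivative[OF wd(2,3)] eq that
    by (rule AE_m_eq_imp_eq)
  then have "scale_derivative I s v = scale_derivative I s w" by (rule scale_derivative_cong)
  then show ?thesis
    using vd(4) wd by (intro restricted_domainI[OF wd(1-3)]) simp
qed

text \<open>\<open>g n\<close> equals \<open>U (r n)\<close> only up to null sets, because the
  infimum in \<open>extended_energy\<close> supplies its own representatives.\<close>

lemma locally_tends_subseq:
  assumes U: "locally_tends U u" and r: "filterlim r at_top sequentially"
    and g: "\<And>n. g n \<in> L2 m" "\<And>n. U n \<in> L2 m" "\<And>n. AE x in m. U (r n) x = g n x"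
  shows "locally_tends g u"
  unfolding locally_tends_def
proof (intro ballI impI)
  fix c d A assume A: "c \<in> I" "d \<in> I" "A \<in> sets m" "A \<subseteq> {c<..d}"
  note [measurable] = L2_measurable[OF g(1)] L2_measurable[OF g(2)] A(3)
  have "(LINT x:A|m. U (r n) x) = (LINT x:A|m. g n x)" for n
    unfolding set_lebesgue_integral_def using g(3)[of n] by (intro integral_cong_AE) auto
  then show "(\<lambda>n. LINT x:A|m. g n x) \<longlonglongrightarrow> (LINT x:A|m. u x)"
    using filterlim_compose[OF locally_tendsD[OF U A] r] by simp
qed

section \<open>Decreasing sequences of fat sets\<close>

context
  fixes G :: "nat \<Rightarrow> real set"
  assumes fat: "\<And>n. G n \<in> fat_sets I s"
    and dec: "\<And>n. AE x in stieltjes I s. x \<in> G (Suc n) \<longrightarrow> x \<in> G n"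
begin

lemma G_antimono: "k \<le> n \<Longrightarrow> AE x in M. x \<in> G n \<longrightarrow> x \<in> G k"
proof (induction rule: dec_induct)
  case (step n)
  from step.IH dec[of n] show ?case by eventually_elim blast
qed simp

lemma restricted_domain_antimono:
  assumes "k \<le> n"
  shows "restricted_domain I s m (I - G n) \<subseteq> restricted_domain I s m (I - G k)"
proof
  fix u assume u: "u \<in> restricted_domain I s m (I - G n)"
  have "AE x in M. x \<in> I - G k \<longrightarrow> scale_derivative I s u x = 0"
    using restricted_domainD(4)[OF u] G_antimono[OF assms] by eventually_elim blast
  then show "u \<in> restricted_domain I s m (I - G k)"
    using u by (simp add: restricted_domain_def)
qed

text \<open>Countably many exceptional null sets merge into one. The limit domain can therefore be
  tested one index at a time.\<close>

lemma restricted_domain_INT: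
  "restricted_domain I s m (I - (\<Inter>n. G n)) = (\<Inter>n. restricted_domain I s m (I - G n))"
proof -
  have "(AE x in M. x \<in> I - (\<Inter>n. G n) \<longrightarrow> f x = 0) \<longleftrightarrow> (\<forall>n. AE x in M. x \<in> I - G n \<longrightarrow> f x = 0)" for f :: "real \<Rightarrow> real"
    unfolding AE_all_countable[symmetric] by (intro AE_cong) auto
  then show ?thesis by (auto simp: restricted_domain_def)
qed

lemma G_compl_sets: "I - G n \<in> sets M"
  using fat[of n] sets.compl_sets[of "G n" M] by (simp add: fat_sets_def space_M)

text \<open>If some \<open>C\<close> separated the two sides, infinitely many \<open>U n\<close>
  would have representatives of energy below \<open>C\<close>. For fixed \<open>k\<close> these
  eventually lie in the domain of index \<open>k\<close>, and lower semicontinuity there yields a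
  representative of \<open>u\<close> of energy at most \<open>C\<close>.\<close>

lemma mosco_liminf:
  assumes U: "weakly_converges_L2 m U u"
  shows "extended_energy m (restricted_domain I s m (I - (\<Inter>n. G n))) (energy I s) u
    \<le> liminf (\<lambda>n. extended_energy m (restricted_domain I s m (I - G n)) (energy I s) (U n))"
    (is "?E u \<le> liminf ?En")
proof (rule ccontr)
  assume "\<not> ?E u \<le> liminf ?En"
  then have "liminf ?En < ?E u" by (simp only: not_le)
  \<comment> \<open>A real \<open>C\<close> strictly in between treats finite and infinite energy of
    \<open>u\<close> alike.\<close>
  from ereal_dense2[OF this] obtain C where C: "liminf ?En < ereal C" "ereal C < ?E u"
    by blast
  have UL2: "\<And>n. U n \<in> L2 m" and uL2: "u \<in> L2 m" and Uu: "locally_tends U u"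
    using U weakly_converges_locally_tends[OF U] by (auto simp: weakly_converges_L2_def)
  have "\<exists>n\<ge>j. ?En n < ereal C" for j
  proof (rule ccontr)
    assume "\<not> (\<exists>n\<ge>j. ?En n < ereal C)"
    then have "eventually (\<lambda>n. ereal C \<le> ?En n) sequentially"
      unfolding eventually_sequentially by (intro exI[of _ j]) (auto simp: not_less)
    then have "ereal C \<le> liminf ?En" by (rule Liminf_bounded)
    with C(1) show False by simp
  qed
  then have "\<exists>n w. j \<le> n \<and> w \<in> restricted_domain I s m (I - G n) \<and> (AE x in m. U n x = w x) \<and> energy I s w w < C" for j
    unfolding extended_energy_def INF_less_iff by fastforce
  then obtain r w where r: "\<And>j. j \<le> r j" and w: "\<And>j. w j \<in> restricted_domain I s m (I - G (r j))"
    and Uw: "\<And>j. AE x in m. U (r j) x = w j x" and wC: "\<And>j. energy I s (w j) (w j) < C"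
    by metis
  have "\<exists>v. v \<in> restricted_domain I s m (I - G k) \<and> (AE x in m. u x = v x) \<and> energy I s v v \<le> C" for k
  proof -
    \<comment> \<open>The shift makes \<open>r (j + k)\<close> at least \<open>k\<close>, so the
      whole shifted sequence lies in one fixed domain.\<close>
    have g: "w (j + k) \<in> restricted_domain I s m (I - G k)" for j
      using w[of "j + k"] restricted_domain_antimono[of k "r (j + k)"] r[of "j + k"] by auto
    have "filterlim (\<lambda>j. r (j + k)) at_top sequentially"
    proof (rule filterlim_at_top_mono[OF filterlim_ident always_eventually], rule allI)
      show "j \<le> r (j + k)" for j using r[of "j + k"] by simp
    qed
    then have tends: "locally_tends (\<lambda>j. w (j + k)) u"
      using Uw by (intro locally_tends_subseq[OF Uu] restricted_domainD(1)[OF g] UL2)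
    show ?thesis
      by (rule energy_weakly_lsc[OF g G_compl_sets less_imp_le[OF wC] uL2 tends]) blast
  qed
  then obtain v where v: "\<And>k. v k \<in> restricted_domain I s m (I - G k)" "\<And>k. AE x in m. u x = v k x"
    "\<And>k. energy I s (v k) (v k) \<le> C"
    by metis
  \<comment> \<open>The limits found for different \<open>k\<close> represent the same class
    \<open>u\<close>, so they agree on \<open>I\<close> and \<open>v 0\<close> inherits all the
    constraints.\<close>
  have "v 0 \<in> restricted_domain I s m (I - G k)" for k
  proof (rule restricted_domain_eq_representative[OF v(1) v(1)])
    show "AE x in m. v k x = v 0 x" using v(2)[of k] v(2)[of 0] by eventually_elim simp
  qed
  then have "v 0 \<in> restricted_domain I s m (I - (\<Inter>n. G n))"
    by (simp add: restricted_domain_INT)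
  then have "?E u \<le> ereal (energy I s (v 0) (v 0))"
    unfolding extended_energy_def using v(2) by (intro INF_lower) auto
  also have "\<dots> \<le> ereal C" using v(3) by simp
  finally show False using C(2) by simp
qed

lemma mosco_associated_scales:
  "mosco_converges m
     (\<lambda>n. form_domain I (associated_scale I s e (G n)) m) (\<lambda>n. energy I (associated_scale I s e (G n)))
     (restricted_domain I s m (I - (\<Inter>n. G n))) (energy I s)"
  unfolding mosco_converges_def extended_energy_associated[OF fat]
proof (intro conjI allI ballI impI)
  show "closed_form_wide m (form_domain I (associated_scale I s e (G n)) m) (energy I (associated_scale I s e (G n)))" for n
  proof -
    \<comment> \<open>Closedness comes from the general result for the scale of \<open>G n\<close>
      itself, with \<open>F\<close> empty.\<close>
    interpret T: interval_form a b I "associated_scale I s e (G n)" m e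
      by (rule interval_form_associated_scale[OF fat])
    show ?thesis
      unfolding T.form_domain_eq_restricted by (rule T.closed_form_restricted) simp
  qed
  have "(\<Union>n. I - G n) \<in> sets M" using G_compl_sets by (intro sets.countable_UN) auto
  moreover have "(\<Union>n. I - G n) = I - (\<Inter>n. G n)" by auto
  ultimately have "I - (\<Inter>n. G n) \<in> sets M" by (simp only:)
  then show "closed_form_wide m (restricted_domain I s m (I - (\<Inter>n. G n))) (energy I s)"
    by (rule closed_form_restricted)
next
  fix U u assume "weakly_converges_L2 m U u"
  then show "extended_energy m (restricted_domain I s m (I - (\<Inter>n. G n))) (energy I s) u
      \<le> liminf (\<lambda>n. extended_energy m (restricted_domain I s m (I - G n)) (energy I s) (U n))"
    by (rule mosco_liminf)
next
  fix u assume "u \<in> L2 m"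
  then have "strongly_converges_L2 m (\<lambda>n. u) u"
    by (simp add: strongly_converges_L2_def)
  moreover have "extended_energy m (restricted_domain I s m (I - G n)) (energy I s) u
      \<le> extended_energy m (restricted_domain I s m (I - (\<Inter>n. G n))) (energy I s) u" for n
    unfolding extended_energy_def restricted_domain_INT by (intro INF_superset_mono) auto
  then have "limsup (\<lambda>n. extended_energy m (restricted_domain I s m (I - G n)) (energy I s) u)
      \<le> extended_energy m (restricted_domain I s m (I - (\<Inter>n. G n))) (energy I s) u"
    by (intro Limsup_bounded always_eventually allI)
  ultimately show "\<exists>U. strongly_converges_L2 m U u \<and>
      limsup (\<lambda>n. extended_energy m (restricted_domain I s m (I - G n)) (energy I s) (U n))
      \<le> extended_energy m (restricted_domain I s m (I - (\<Inter>n. G n))) (energy I s) u"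
    by (intro exI[of _ "\<lambda>n. u"] conjI)
qed

end

end

theorem theorem3p8:
  fixes a b :: ereal and I :: "real set" and m :: "real measure"
    and s :: "real \<Rightarrow> real" and e :: real and G :: "nat \<Rightarrow> real set"
  assumes "a < b" and "I = einterval a b"
    and "fully_supported_radon I m"
    and "scaling_function I s"
    and "e \<in> I"
    and "\<And>n. G n \<in> fat_sets I s"
    and "\<And>n. AE x in stieltjes I s. x \<in> G (Suc n) \<longrightarrow> x \<in> G n"
  shows "mosco_converges m
           (\<lambda>n. form_domain I (associated_scale I s e (G n)) m)
           (\<lambda>n. energy I (associated_scale I s e (G n)))
           (restricted_domain I s m (I - (\<Inter>n. G n)))
           (energy I s)"
proof -
  interpret interval_form a b I s m e
    by unfold_locales (use assms in auto)
  show ?thesis by (rule mosco_associated_scales) (use assms in auto)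
qed

end
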